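(* Let the states take values in a finite set $\mathcal{A}=\{a_1,\dots,a_{|\mathcal{A}|}\}$, let $\Delta\ge 0$ be the number of lookahead steps, and run the single-pilot lookahead algorithm (described in the context, including its optional resampling steps) with $m$ samples. Then at time $t=1,2,\dots$ the weighted sample $(\mathbf{x}_t^{(j)},w_t^{\mathrm{aux}(j)})$ obtained by the algorithm is properly weighted with respect to $\pi_{t+\Delta}(\mathbf{x}_t)$, and the estimator $$\frac{\sum_{j=1}^m w_{t-1}^{(j)}\sum_{i=1}^{|\mathcal{A}|}U_t^{(j,i)}\,h\big(\mathbf{x}_{t-1}^{(j)},x_t=a_i\big)}{\sum_{j=1}^m w_t^{\mathrm{aux}(j)}}$$ is a consistent estimator (as the Monte Carlo sample size $m\to\infty$) of $E_{\pi_{t+\Delta}}\big(h(\mathbf{x}_t)\big)=E\big(h(\mathbf{x}_t)\mid\mathbf{y}_{t+\Delta}\big)$.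
   Context: Latent states $x_0,x_1,\dots$ take values in $\mathcal{A}$ and $y_1,y_2,\dots$ are observations. Write $\mathbf{x}_t=(x_0,\dots,x_t)$, $\mathbf{x}_{a:b}=(x_a,\dots,x_b)$, $\mathbf{y}_t=(y_1,\dots,y_t)$, $\pi_t(\mathbf{x}_t)=p(\mathbf{x}_t\mid\mathbf{y}_t)$, and for any $s,t$ let $\pi_t(\mathbf{x}_s)=p(\mathbf{x}_s\mid\mathbf{y}_t)$. The function $h(\mathbf{x}_t)$ is the function of the state whose expectation is to be estimated. Expectations are taken conditional on $\mathbf{y}_{t+\Delta}$. Properly weighted: a random pair $(\mathbf{x},w)$ is properly weighted with respect to a distribution $\pi$ if $E[w\,h(\mathbf{x})]=E_\pi[h(\mathbf{x})]$ for functions $h$; for instance, $\mathbf{x}$ drawn from a trial distribution $r$ whose support covers that of $\pi$, with $w=\pi(\mathbf{x})/r(\mathbf{x})$. Trial distributions are assumed to have supports covering those of their targets. In the setup of a step at time $t\ge1$, the set of samples $\{(\mathbf{x}_{t-1}^{(j)},w_{t-1}^{(j)}),\,j=1,\dots,m\}$ is taken to be properly weighted with respect to $\pi_{t-1}(\mathbf{x}_{t-1})$. Resampling with priority scores $\alpha^{(j)}>0$: from a weighted set $\{(\mathbf{x}^{(j)},w^{(j)}),j=1,\dots,m\}$, for each $j=1,\dots,m$ draw $\mathbf{x}^{*(j)}$ at random from $\{\mathbf{x}^{(1)},\dots,\mathbf{x}^{(m)}\}$ with probabilities proportional to $\alpha^{(1)},\dots,\alpha^{(m)}$; if $\mathbf{x}^{*(j)}=\mathbf{x}^{(j_0)}$,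 give it the new weight $w^{*(j)}=w^{(j_0)}/\alpha^{(j_0)}$; the new set $\{(\mathbf{x}^{*(j)},w^{*(j)})\}$ replaces the old one (it is regarded as approximately properly weighted with respect to the same distribution as the old set). Single-pilot lookahead algorithm. Here $q_0$ and the $q_s^{\mathrm{pilot}}$ are given trial (conditional) distributions. At time $t=0$, for $j=1,\dots,m$: draw $x_0^{(j)}$ from $q_0(x_0)$; set $w_0^{(j)}=\pi_0(x_0^{(j)})/q_0(x_0^{(j)})$; generate a pilot path $\mathbf{x}_{1:\Delta}^{(j,* )}$ from $\prod_{s=1}^{\Delta}q_s^{\mathrm{pilot}}(x_s\mid x_0^{(j)},\mathbf{x}_{1:s-1})$ and calculate $$w_0^{\mathrm{aux}(j)}=w_0^{(j)}\frac{\pi_\Delta\big(x_0^{(j)},\mathbf{x}_{1:\Delta}^{(j,* )}\big)}{\pi_0(x_0^{(j)})\prod_{s=1}^{\Delta}q_s^{\mathrm{pilot}}\big(x_s^{(j,* )}\mid x_0^{(j)},\mathbf{x}_{1:s-1}^{(j,* )}\big)}.$$ At times $t=1,2,\dots$: (a) (Optional.) Resample $\{(\mathbf{x}_{t-1}^{(j)},w_{t-1}^{(j)}),j=1,\dots,m\}$ with priority scores $\alpha_{t-1}^{(j)}=w_{t-1}^{\mathrm{aux}(j)}$; the resulting set is again denoted $\{(\mathbf{x}_{t-1}^{(j)},w_{t-1}^{(j)})\}$. (b) For $j=1,\dots,m$: Generating pilots: for $x_t=a_i$, $i=1,\dots,|\mathcal{A}|$, draw $\mathbf{x}_{t+1:t+\Delta}^{(j,i)}=(x_{t+1}^{(j,i)},\dots,x_{t+\Delta}^{(j,i)})$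 sequentially from $$\prod_{s=t+1}^{t+\Delta}q_s^{\mathrm{pilot}}\big(x_s\mid\mathbf{x}_{t-1}^{(j)},x_t=a_i,\mathbf{x}_{t+1:s-1}\big)$$ and calculate $$U_t^{(j,i)}=\frac{\pi_{t+\Delta}\big(\mathbf{x}_{t-1}^{(j)},x_t=a_i,\mathbf{x}_{t+1:t+\Delta}^{(j,i)}\big)}{\pi_{t-1}\big(\mathbf{x}_{t-1}^{(j)}\big)\prod_{s=t+1}^{t+\Delta}q_s^{\mathrm{pilot}}\big(x_s^{(j,i)}\mid\mathbf{x}_{t-1}^{(j)},x_t=a_i,\mathbf{x}_{t+1:s-1}^{(j,i)}\big)}.$$ Sampling: draw $x_t^{(j)}$ from $q_t(x_t=a_i\mid\mathbf{x}_{t-1}^{(j)})=U_t^{(j,i)}\big/\sum_{k=1}^{|\mathcal{A}|}U_t^{(j,k)}$ and set $\mathbf{x}_t^{(j)}=(\mathbf{x}_{t-1}^{(j)},x_t^{(j)})$. Updating weights (two sets are kept): $$w_t^{(j)}=w_{t-1}^{(j)}\frac{\pi_t(\mathbf{x}_t^{(j)})}{\pi_{t-1}(\mathbf{x}_{t-1}^{(j)})\,q_t(x_t^{(j)}\mid\mathbf{x}_{t-1}^{(j)})},\qquad w_t^{\mathrm{aux}(j)}=w_{t-1}^{(j)}\sum_{k=1}^{|\mathcal{A}|}U_t^{(j,k)}.$$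
   Formalization: Exact proper weighting is proved for a step from properly weighted input and for runs without resampling; after resampling, where exactness fails (e.g. m=1, Δ=0, q_0≠π_0), it is replaced by E[w_t^aux h(x_t)] → E_{π_{t+Δ}}h as m→∞. Consistency holds with resampling. *)

theory Defs
  imports "HOL-Probability.Probability"
begin

section \<open>State space models and posteriors\<close>

text \<open>
  A path \<open>(x_0, ..., x_t)\<close> is a list of length \<open>t + 1\<close>, and \<open>(y_1, ..., y_t)\<close> is a list of length
  \<open>t\<close>. No Markov property is imposed: \<open>trans\<close> is \<open>p(x_s | x_0..x_{s-1}, y_1..y_{s-1})\<close> and \<open>obs\<close> is
  the density \<open>p(y_s | x_0..x_s, y_1..y_{s-1})\<close> with respect to \<open>base\<close>, so by the chain rule any
  joint law of states and observations with such densities has this form.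
\<close>

record ('a, 'y) ssm =
  prior :: "'a pmf"
  trans :: "'a list \<Rightarrow> 'y list \<Rightarrow> 'a pmf"
  obs :: "'a list \<Rightarrow> 'y list \<Rightarrow> 'y \<Rightarrow> real"
  base :: "'y measure"

definition is_ssm :: "('a, 'y) ssm \<Rightarrow> bool" where
  "is_ssm M \<longleftrightarrow> sigma_finite_measure (base M) \<and>
     (\<forall>xs ys. length xs = length ys + 2 \<longrightarrow> set ys \<subseteq> space (base M) \<longrightarrow>
        obs M xs ys \<in> borel_measurable (base M) \<and> (\<forall>v. 0 \<le> obs M xs ys v) \<and>
        (\<integral>\<^sup>+ v. ennreal (obs M xs ys v) \<partial>base M) = 1)"

text \<open>Observations are indexed from 1; \<open>y 0\<close> is never used.\<close>

definition obs_upto :: "(nat \<Rightarrow> 'y) \<Rightarrow> nat \<Rightarrow> 'y list" where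
  "obs_upto y t = map y [1..<t + 1]"

definition joint :: "('a, 'y) ssm \<Rightarrow> (nat \<Rightarrow> 'y) \<Rightarrow> nat \<Rightarrow> 'a list \<Rightarrow> real" where
  "joint M y t xs = pmf (prior M) (xs ! 0) *
     (\<Prod>s = 1..t. pmf (trans M (take s xs) (obs_upto y (s - 1))) (xs ! s) *
                 obs M (take (s + 1) xs) (obs_upto y (s - 1)) (y s))"

definition evidence :: "('a::finite, 'y) ssm \<Rightarrow> (nat \<Rightarrow> 'y) \<Rightarrow> nat \<Rightarrow> real" where
  "evidence M y t = (\<Sum>xs | length xs = t + 1. joint M y t xs)"

definition posterior :: "('a::finite, 'y) ssm \<Rightarrow> (nat \<Rightarrow> 'y) \<Rightarrow> nat \<Rightarrow> 'a list pmf" where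
  "posterior M y t =
     embed_pmf (\<lambda>xs. if length xs = t + 1 then joint M y t xs / evidence M y t else 0)"

lemma pmf_posterior:
  assumes M: "is_ssm M" and y: "\<And>s. s \<ge> 1 \<Longrightarrow> y s \<in> space (base M)" and ev: "evidence M y t > 0"
  shows "pmf (posterior M y t) xs =
           (if length xs = t + 1 then joint M y t xs / evidence M y t else 0)"
proof -
  let ?f = "\<lambda>xs :: 'a list. if length xs = t + 1 then joint M y t xs / evidence M y t else 0"
  let ?A = "{xs :: 'a list. length xs = t + 1}"
  have fin: "finite ?A"
    using finite_lists_length_eq[of "UNIV :: 'a set" "t + 1"] by simp
  have J: "joint M y t xs \<ge> 0" if len: "length xs = t + 1" for xs :: "'a list"
  proof -
    have "0 \<le> obs M (take (s + 1) xs) (obs_upto y (s - 1)) (y s)" if s: "s \<in> {1..t}" for s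
    proof -
      have "length (take (s + 1) xs) = length (obs_upto y (s - 1)) + 2"
        using len s by (auto simp: obs_upto_def)
      moreover have "set (obs_upto y (s - 1)) \<subseteq> space (base M)"
        using y by (auto simp: obs_upto_def)
      ultimately show ?thesis using M unfolding is_ssm_def by blast
    qed
    then show ?thesis unfolding joint_def
      by (intro mult_nonneg_nonneg prod_nonneg) auto
  qed
  have nn: "?f xs \<ge> 0" for xs using J ev by auto
  have "(\<integral>\<^sup>+ xs. ennreal (?f xs) \<partial>count_space UNIV) = (\<Sum>xs\<in>?A. ennreal (?f xs))"
    by (rule nn_integral_count_space'[OF fin]) auto
  also have "\<dots> = ennreal (\<Sum>xs\<in>?A. ?f xs)"
    by (rule sum_ennreal) (use nn in blast)
  also have "(\<Sum>xs\<in>?A. ?f xs) = 1"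
    using ev by (simp add: evidence_def sum_divide_distrib[symmetric])
  finally have one: "(\<integral>\<^sup>+ xs. ennreal (?f xs) \<partial>count_space UNIV) = 1" by simp
  show ?thesis unfolding posterior_def using nn one by (rule pmf_embed_pmf)
qed

definition prefix_law :: "(nat \<Rightarrow> 'a list pmf) \<Rightarrow> nat \<Rightarrow> nat \<Rightarrow> 'a list pmf" where
  "prefix_law \<pi> t s = map_pmf (take (s + 1)) (\<pi> t)"

section \<open>Proper weighting and consistency\<close>

definition properly_weighted :: "('x \<times> real) pmf \<Rightarrow> 'x pmf \<Rightarrow> bool" where
  "properly_weighted D \<rho> \<longleftrightarrow> (\<forall>h :: 'x \<Rightarrow> real. integrable (measure_pmf \<rho>) h \<longrightarrow>
     integrable (measure_pmf D) (\<lambda>(x, w). w * h x) \<and>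
     measure_pmf.expectation D (\<lambda>(x, w). w * h x) = measure_pmf.expectation \<rho> h)"

text \<open>The sample of size \<open>m\<close> has law \<open>P m\<close>; the laws for different \<open>m\<close> live on unrelated
  probability spaces, so consistency is convergence in probability to the constant \<open>\<theta>\<close>.\<close>

definition consistent_estimator :: "(nat \<Rightarrow> 'o pmf) \<Rightarrow> (nat \<Rightarrow> 'o \<Rightarrow> real) \<Rightarrow> real \<Rightarrow> bool" where
  "consistent_estimator P est \<theta> \<longleftrightarrow>
     (\<forall>\<epsilon>>0. (\<lambda>m. measure_pmf.prob (P m) {\<omega>. \<bar>est m \<omega> - \<theta>\<bar> \<ge> \<epsilon>}) \<longlonglongrightarrow> 0)"

section \<open>Resampling with priority scores\<close>

text \<open>Samples of size \<open>m\<close> are functions on \<open>nat\<close> of which only the values below \<open>m\<close> matter. If the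
  scores are not positive, \<open>priority_pmf\<close> is an unspecified law.\<close>

definition priority_pmf :: "nat \<Rightarrow> (nat \<Rightarrow> real) \<Rightarrow> nat pmf" where
  "priority_pmf m \<alpha> = embed_pmf (\<lambda>k. if k < m then \<alpha> k / (\<Sum>l<m. \<alpha> l) else 0)"

definition resample ::
  "nat \<Rightarrow> (nat \<Rightarrow> real) \<Rightarrow> (nat \<Rightarrow> 'a list \<times> real) \<Rightarrow> (nat \<Rightarrow> 'a list \<times> real) pmf" where
  "resample m \<alpha> X = Pi_pmf {..<m} ([], 0)
     (\<lambda>_. map_pmf (\<lambda>k. (fst (X k), snd (X k) / \<alpha> k)) (priority_pmf m \<alpha>))"

section \<open>The single-pilot lookahead algorithm\<close>

text \<open>\<open>q s xs\<close> is the pilot trial law of \<open>x_s\<close> given \<open>xs = (x_0, ..., x_{s-1})\<close>; \<open>pilot q n xs\<close> is the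
  law of \<open>n\<close> further states drawn sequentially after \<open>xs\<close>.\<close>

fun pilot :: "(nat \<Rightarrow> 'a list \<Rightarrow> 'a pmf) \<Rightarrow> nat \<Rightarrow> 'a list \<Rightarrow> 'a list pmf" where
  "pilot q 0 xs = return_pmf []"
| "pilot q (Suc n) xs =
     do { x \<leftarrow> q (length xs) xs; z \<leftarrow> pilot q n (xs @ [x]); return_pmf (x # z) }"

definition pilot_density :: "(nat \<Rightarrow> 'a list \<Rightarrow> 'a pmf) \<Rightarrow> 'a list \<Rightarrow> 'a list \<Rightarrow> real" where
  "pilot_density q xs z =
     (\<Prod>i<length z. pmf (q (length xs + i) (xs @ take i z)) (z ! i))"

lemma pmf_pilot: "pmf (pilot q n xs) z = (if length z = n then pilot_density q xs z else 0)"
proof (induction n arbitrary: xs z)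
  case 0
  then show ?case by (auto simp: pilot_density_def indicator_def)
next
  case (Suc n)
  show ?case
  proof (cases z)
    case Nil
    have "z \<notin> set_pmf (pilot q (Suc n) xs)" using Nil by auto
    then show ?thesis using Nil by (simp add: pmf_eq_0_set_pmf)
  next
    case (Cons a z')
    have "pilot q (Suc n) xs = bind_pmf (q (length xs) xs)
            (\<lambda>x. map_pmf ((#) x) (pilot q n (xs @ [x])))"
      by (simp add: map_pmf_def)
    moreover have "pmf (map_pmf ((#) x) (pilot q n (xs @ [x]))) z =
        indicator {a} x * pmf (pilot q n (xs @ [a])) z'" for x
    proof (cases "x = a")
      case True
      then show ?thesis
        using pmf_map_inj'[of "(#) a" "pilot q n (xs @ [a])" z'] Cons by simp
    next
      case False
      then have "z \<notin> set_pmf (map_pmf ((#) x) (pilot q n (xs @ [x])))" using Cons by auto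
      then show ?thesis using False by (simp add: pmf_eq_0_set_pmf)
    qed
    ultimately have "pmf (pilot q (Suc n) xs) z =
        pmf (q (length xs) xs) a * pmf (pilot q n (xs @ [a])) z'"
      by (simp add: pmf_bind measure_pmf_single del: pilot.simps)
    moreover have "pilot_density q xs (a # z') =
        pmf (q (length xs) xs) a * pilot_density q (xs @ [a]) z'"
      unfolding pilot_density_def by (simp add: prod.lessThan_Suc_shift del: prod.lessThan_Suc)
    ultimately show ?thesis using Cons Suc.IH by simp
  qed
qed

record 'a particle =
  hist :: "'a list"
  wgt :: real
  aux :: real

definition no_particle :: "'a particle" where
  "no_particle = \<lparr>hist = [], wgt = 0, aux = 0\<rparr>"

definition init_particle ::
  "(nat \<Rightarrow> 'a list pmf) \<Rightarrow> nat \<Rightarrow> 'a pmf \<Rightarrow> (nat \<Rightarrow> 'a list \<Rightarrow> 'a pmf) \<Rightarrow> 'a particle pmf" where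
  "init_particle \<pi> \<Delta> q0 q = do {
     x \<leftarrow> q0;
     z \<leftarrow> pilot q \<Delta> [x];
     let w = pmf (\<pi> 0) [x] / pmf q0 x;
     return_pmf \<lparr>hist = [x], wgt = w,
       aux = w * (pmf (\<pi> \<Delta>) (x # z) / (pmf (\<pi> 0) [x] * pilot_density q [x] z))\<rparr> }"

text \<open>Everything drawn for one sample in one step, together with its input
  \<open>(past, past_wgt)\<close>: \<open>pilots a\<close> is the pilot generated for \<open>x_t = a\<close>, and \<open>cur\<close> is \<open>x_t\<close>.\<close>

record 'a draw =
  past :: "'a list"
  past_wgt :: real
  pilots :: "'a \<Rightarrow> 'a list"
  cur :: 'a

definition U ::
  "(nat \<Rightarrow> 'a list pmf) \<Rightarrow> nat \<Rightarrow> (nat \<Rightarrow> 'a list \<Rightarrow> 'a pmf) \<Rightarrow> nat \<Rightarrow> 'a list \<Rightarrow> ('a \<Rightarrow> 'a list) \<Rightarrow> 'a \<Rightarrow> real"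
where
  "U \<pi> \<Delta> q t xs zs a =
     pmf (\<pi> (t + \<Delta>)) (xs @ [a] @ zs a) /
     (pmf (\<pi> (t - 1)) xs * pilot_density q (xs @ [a]) (zs a))"

definition trial_prob ::
  "(nat \<Rightarrow> 'a::finite list pmf) \<Rightarrow> nat \<Rightarrow> (nat \<Rightarrow> 'a list \<Rightarrow> 'a pmf) \<Rightarrow> nat \<Rightarrow> 'a list \<Rightarrow> ('a \<Rightarrow> 'a list) \<Rightarrow> 'a \<Rightarrow> real"
where
  "trial_prob \<pi> \<Delta> q t xs zs a = U \<pi> \<Delta> q t xs zs a / (\<Sum>b\<in>UNIV. U \<pi> \<Delta> q t xs zs b)"

text \<open>If all \<open>U\<close> vanish, the law of \<open>cur\<close> is unspecified, and both new weights are 0.\<close>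

definition step ::
  "(nat \<Rightarrow> 'a::finite list pmf) \<Rightarrow> nat \<Rightarrow> (nat \<Rightarrow> 'a list \<Rightarrow> 'a pmf) \<Rightarrow> nat \<Rightarrow> 'a list \<times> real \<Rightarrow> 'a draw pmf"
where
  "step \<pi> \<Delta> q t p = do {
     zs \<leftarrow> Pi_pmf UNIV [] (\<lambda>a. pilot q \<Delta> (fst p @ [a]));
     x \<leftarrow> embed_pmf (trial_prob \<pi> \<Delta> q t (fst p) zs);
     return_pmf \<lparr>past = fst p, past_wgt = snd p, pilots = zs, cur = x\<rparr> }"

abbreviation U_of ::
  "(nat \<Rightarrow> 'a list pmf) \<Rightarrow> nat \<Rightarrow> (nat \<Rightarrow> 'a list \<Rightarrow> 'a pmf) \<Rightarrow> nat \<Rightarrow> 'a draw \<Rightarrow> 'a \<Rightarrow> real" where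
  "U_of \<pi> \<Delta> q t d \<equiv> U \<pi> \<Delta> q t (past d) (pilots d)"

definition outcome ::
  "(nat \<Rightarrow> 'a::finite list pmf) \<Rightarrow> nat \<Rightarrow> (nat \<Rightarrow> 'a list \<Rightarrow> 'a pmf) \<Rightarrow> nat \<Rightarrow> 'a draw \<Rightarrow> 'a particle" where
  "outcome \<pi> \<Delta> q t d =
     \<lparr>hist = past d @ [cur d],
      wgt = past_wgt d * (pmf (\<pi> t) (past d @ [cur d]) /
        (pmf (\<pi> (t - 1)) (past d) * trial_prob \<pi> \<Delta> q t (past d) (pilots d) (cur d))),
      aux = past_wgt d * (\<Sum>a\<in>UNIV. U_of \<pi> \<Delta> q t d a)\<rparr>"

definition steps ::
  "(nat \<Rightarrow> 'a::finite list pmf) \<Rightarrow> nat \<Rightarrow> (nat \<Rightarrow> 'a list \<Rightarrow> 'a pmf) \<Rightarrow> nat \<Rightarrow> nat \<Rightarrow>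
   (nat \<Rightarrow> 'a list \<times> real) \<Rightarrow> (nat \<Rightarrow> 'a draw) pmf"
where
  "steps \<pi> \<Delta> q m t X = Pi_pmf {..<m} undefined (\<lambda>j. step \<pi> \<Delta> q t (X j))"

text \<open>Whether to resample at time \<open>t\<close> may depend on the current set of weighted samples, but not on
  the labels of the samples, whence a predicate \<open>dec t\<close> on multisets. A fixed resampling schedule is
  the special case of a \<open>dec t\<close> that ignores its argument (up to its size \<open>m\<close>).\<close>

definition sample_set :: "nat \<Rightarrow> (nat \<Rightarrow> 'a particle) \<Rightarrow> 'a particle multiset" where
  "sample_set m S = image_mset S (mset_set {..<m})"

definition optional_resample ::
  "(nat \<Rightarrow> 'a particle multiset \<Rightarrow> bool) \<Rightarrow> nat \<Rightarrow> nat \<Rightarrow> (nat \<Rightarrow> 'a particle) \<Rightarrow> (nat \<Rightarrow> 'a list \<times> real) pmf"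
where
  "optional_resample dec m t S =
     (let X = (\<lambda>j. (hist (S j), wgt (S j)))
      in if dec t (sample_set m S) then resample m (\<lambda>j. aux (S j)) X else return_pmf X)"

text \<open>\<open>draws \<dots> m t S\<close>: optional resampling, then the draws of time \<open>t\<close>, started from the particles \<open>S\<close> of time \<open>t - 1\<close>.
  \<open>lookahead \<dots> m t\<close>: the law of the particles at time \<open>t\<close>.
  \<open>lookahead_draws \<dots> m t\<close>: the law of everything drawn at time \<open>t \<ge> 1\<close>.\<close>

definition draws ::
  "(nat \<Rightarrow> 'a::finite list pmf) \<Rightarrow> nat \<Rightarrow> (nat \<Rightarrow> 'a list \<Rightarrow> 'a pmf) \<Rightarrow> (nat \<Rightarrow> 'a particle multiset \<Rightarrow> bool) \<Rightarrow>
   nat \<Rightarrow> nat \<Rightarrow> (nat \<Rightarrow> 'a particle) \<Rightarrow> (nat \<Rightarrow> 'a draw) pmf"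
where
  "draws \<pi> \<Delta> q dec m t S = optional_resample dec m t S \<bind> steps \<pi> \<Delta> q m t"

primrec lookahead ::
  "(nat \<Rightarrow> 'a::finite list pmf) \<Rightarrow> nat \<Rightarrow> 'a pmf \<Rightarrow> (nat \<Rightarrow> 'a list \<Rightarrow> 'a pmf) \<Rightarrow>
   (nat \<Rightarrow> 'a particle multiset \<Rightarrow> bool) \<Rightarrow> nat \<Rightarrow> nat \<Rightarrow> (nat \<Rightarrow> 'a particle) pmf"
where
  "lookahead \<pi> \<Delta> q0 q dec m 0 = Pi_pmf {..<m} no_particle (\<lambda>_. init_particle \<pi> \<Delta> q0 q)"
| "lookahead \<pi> \<Delta> q0 q dec m (Suc t) = do {
     S \<leftarrow> lookahead \<pi> \<Delta> q0 q dec m t;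
     T \<leftarrow> draws \<pi> \<Delta> q dec m (Suc t) S;
     return_pmf (\<lambda>j. if j < m then outcome \<pi> \<Delta> q (Suc t) (T j) else no_particle) }"

definition lookahead_draws ::
  "(nat \<Rightarrow> 'a::finite list pmf) \<Rightarrow> nat \<Rightarrow> 'a pmf \<Rightarrow> (nat \<Rightarrow> 'a list \<Rightarrow> 'a pmf) \<Rightarrow>
   (nat \<Rightarrow> 'a particle multiset \<Rightarrow> bool) \<Rightarrow> nat \<Rightarrow> nat \<Rightarrow> (nat \<Rightarrow> 'a draw) pmf"
where
  "lookahead_draws \<pi> \<Delta> q0 q dec m t =
     lookahead \<pi> \<Delta> q0 q dec m (t - 1) \<bind> draws \<pi> \<Delta> q dec m t"

definition aux_sample ::
  "(nat \<Rightarrow> 'a::finite list pmf) \<Rightarrow> nat \<Rightarrow> (nat \<Rightarrow> 'a list \<Rightarrow> 'a pmf) \<Rightarrow> nat \<Rightarrow> 'a draw \<Rightarrow> 'a list \<times> real" where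
  "aux_sample \<pi> \<Delta> q t d = (hist (outcome \<pi> \<Delta> q t d), aux (outcome \<pi> \<Delta> q t d))"

definition estimator ::
  "(nat \<Rightarrow> 'a::finite list pmf) \<Rightarrow> nat \<Rightarrow> (nat \<Rightarrow> 'a list \<Rightarrow> 'a pmf) \<Rightarrow> nat \<Rightarrow> ('a list \<Rightarrow> real) \<Rightarrow>
   nat \<Rightarrow> (nat \<Rightarrow> 'a draw) \<Rightarrow> real"
where
  "estimator \<pi> \<Delta> q t h m T =
     (\<Sum>j<m. past_wgt (T j) * (\<Sum>a\<in>UNIV. U_of \<pi> \<Delta> q t (T j) a * h (past (T j) @ [a]))) /
     (\<Sum>j<m. aux (outcome \<pi> \<Delta> q t (T j)))"

end

theory Submission
  imports Defs
begin

text \<open>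
  Given \<open>x_{t-1}\<close> and its weight \<open>w\<close>, the factor \<open>\<Sum>k. U k\<close> of the auxiliary weight cancels the
  normalisation of the trial probabilities, and importance weighting of the pilots turns the conditional
  mean of \<open>U k\<close> into \<open>p(x_{t-1}, x_t = a_k | y_{t+\<Delta>}) / \<pi>_{t-1}(x_{t-1})\<close>; averaging over a properly
  weighted \<open>(x_{t-1}, w)\<close> then telescopes to \<open>\<pi>_{t+\<Delta>}\<close>.

  For consistency, induction on time shows that the averages of \<open>w h(x)\<close> and of the auxiliary weights
  converge in mean square to \<open>E h\<close> under \<open>\<pi>_t\<close> and to 1. At each fixed time the particles take finitely
  many values, independently of \<open>m\<close>, so conditionally independent draws add a variance \<open>O(1/m)\<close>, and
  positive scores are bounded away from 0. Resampling replaces the average of \<open>w h(x)\<close> by its ratio to the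
  average score, whose limit is 1; hence the limit is the same whether or not one resamples, and an
  arbitrary random decision does no harm. Exchangeability of the particles transfers the limit of the
  averages to the mean of each single particle.
\<close>

section \<open>Expectations under probability mass functions\<close>

text \<open>Tonelli for a two-stage draw. It is kept at the level of integrability because the law
  of a properly weighted input may have infinite support.\<close>

lemma bind_pmf_expectation_nonneg:
  fixes f :: "'b \<Rightarrow> real"
  assumes f: "\<And>y. 0 \<le> f y"
    and K: "\<And>x. x \<in> set_pmf p \<Longrightarrow> integrable (measure_pmf (K x)) f"
    and p: "integrable (measure_pmf p) (\<lambda>x. measure_pmf.expectation (K x) f)"
  shows "has_bochner_integral (measure_pmf (p \<bind> K)) f
    (measure_pmf.expectation p (\<lambda>x. measure_pmf.expectation (K x) f))"
proof (rule has_bochner_integral_nn_integral)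
  have "(\<integral>\<^sup>+ y. ennreal (f y) \<partial>measure_pmf (p \<bind> K))
      = (\<integral>\<^sup>+ x. (\<integral>\<^sup>+ y. ennreal (f y) \<partial>measure_pmf (K x)) \<partial>measure_pmf p)"
    by simp
  also have "\<dots> = (\<integral>\<^sup>+ x. ennreal (measure_pmf.expectation (K x) f) \<partial>measure_pmf p)"
    by (intro nn_integral_cong_AE AE_pmfI nn_integral_eq_integral K AE_I2 f)
  also have "\<dots> = ennreal (measure_pmf.expectation p (\<lambda>x. measure_pmf.expectation (K x) f))"
    by (intro nn_integral_eq_integral p AE_I2 Bochner_Integration.integral_nonneg f)
  finally show "(\<integral>\<^sup>+ y. ennreal (f y) \<partial>measure_pmf (p \<bind> K))
      = ennreal (measure_pmf.expectation p (\<lambda>x. measure_pmf.expectation (K x) f))" .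
qed (use f in \<open>auto intro!: Bochner_Integration.integral_nonneg\<close>)

text \<open>Fubini for a two-stage draw: the positive and negative parts of \<open>f\<close> are
  dominated by its absolute value, so the nonnegative case applies to each and the results are
  subtracted.\<close>

lemma bind_pmf_expectation:
  fixes f :: "'b \<Rightarrow> real"
  assumes K: "\<And>x. x \<in> set_pmf p \<Longrightarrow> integrable (measure_pmf (K x)) f"
    and p: "integrable (measure_pmf p) (\<lambda>x. measure_pmf.expectation (K x) (\<lambda>y. \<bar>f y\<bar>))"
  shows "has_bochner_integral (measure_pmf (p \<bind> K)) f
    (measure_pmf.expectation p (\<lambda>x. measure_pmf.expectation (K x) f))"
proof -
  have part: "integrable (measure_pmf p) (\<lambda>x. measure_pmf.expectation (K x) g)"
    and Kpart: "\<And>x. x \<in> set_pmf p \<Longrightarrow> integrable (measure_pmf (K x)) g"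
    if g: "\<And>y. 0 \<le> g y" "\<And>y. g y \<le> \<bar>f y\<bar>" for g
  proof -
    show Kg: "integrable (measure_pmf (K x)) g" if "x \<in> set_pmf p" for x
      using K[OF that] by (rule Bochner_Integration.integrable_bound) (use g in auto)
    show "integrable (measure_pmf p) (\<lambda>x. measure_pmf.expectation (K x) g)"
      using p
    proof (rule Bochner_Integration.integrable_bound)
      show "AE x in measure_pmf p. norm (measure_pmf.expectation (K x) g)
          \<le> norm (measure_pmf.expectation (K x) (\<lambda>y. \<bar>f y\<bar>))"
      proof (rule AE_pmfI)
        fix x assume x: "x \<in> set_pmf p"
        have "measure_pmf.expectation (K x) g \<le> measure_pmf.expectation (K x) (\<lambda>y. \<bar>f y\<bar>)"
          using K[OF x] Kg[OF x] g by (intro integral_mono) auto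
        moreover have "0 \<le> measure_pmf.expectation (K x) g"
          using g by (intro Bochner_Integration.integral_nonneg) auto
        ultimately show "norm (measure_pmf.expectation (K x) g)
            \<le> norm (measure_pmf.expectation (K x) (\<lambda>y. \<bar>f y\<bar>))" by simp
      qed
    qed simp
  qed
  define P where "P = (\<lambda>y. max 0 (f y))"
  define N where "N = (\<lambda>y. max 0 (- f y))"
  have P: "\<And>y. 0 \<le> P y" "\<And>y. P y \<le> \<bar>f y\<bar>" and N: "\<And>y. 0 \<le> N y" "\<And>y. N y \<le> \<bar>f y\<bar>"
    by (auto simp: P_def N_def)
  have f: "f = (\<lambda>y. P y - N y)" by (auto simp: P_def N_def)
  have "measure_pmf.expectation p (\<lambda>x. measure_pmf.expectation (K x) f) =
      measure_pmf.expectation p (\<lambda>x. measure_pmf.expectation (K x) P - measure_pmf.expectation (K x) N)"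
    using Kpart[OF P] Kpart[OF N] unfolding f
    by (intro integral_cong_AE AE_pmfI) auto
  also have "\<dots> = measure_pmf.expectation p (\<lambda>x. measure_pmf.expectation (K x) P) -
      measure_pmf.expectation p (\<lambda>x. measure_pmf.expectation (K x) N)"
    by (intro Bochner_Integration.integral_diff part P N)
  finally show ?thesis
    using has_bochner_integral_diff[OF
        bind_pmf_expectation_nonneg[OF P(1) Kpart[OF P] part[OF P], simplified]
        bind_pmf_expectation_nonneg[OF N(1) Kpart[OF N] part[OF N], simplified]]
    by (simp flip: f)
qed

lemma expectation_bind_pmf_finite:
  fixes f :: "'b \<Rightarrow> real"
  assumes "finite (set_pmf p)" "\<And>x. x \<in> set_pmf p \<Longrightarrow> finite (set_pmf (K x))"
  shows "measure_pmf.expectation (p \<bind> K) f =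
    measure_pmf.expectation p (\<lambda>x. measure_pmf.expectation (K x) f)"
  by (intro has_bochner_integral_integral_eq bind_pmf_expectation integrable_measure_pmf_finite assms)

lemma expectation_cong_pmf:
  fixes f :: "'b \<Rightarrow> real"
  assumes "\<And>x. x \<in> set_pmf p \<Longrightarrow> f x = g x"
  shows "measure_pmf.expectation p f = measure_pmf.expectation p g"
  by (intro integral_cong_AE AE_pmfI assms) auto

lemma expectation_mono_pmf:
  fixes f :: "'b \<Rightarrow> real"
  assumes "finite (set_pmf p)" "\<And>x. x \<in> set_pmf p \<Longrightarrow> f x \<le> g x"
  shows "measure_pmf.expectation p f \<le> measure_pmf.expectation p g"
  by (intro integral_mono_AE AE_pmfI assms integrable_measure_pmf_finite)

lemma expectation_nonneg_pmf:
  fixes f :: "'b \<Rightarrow> real"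
  assumes "\<And>x. 0 \<le> f x"
  shows "0 \<le> measure_pmf.expectation p f"
  using assms by (intro Bochner_Integration.integral_nonneg)

lemma expectation_Pi_pmf_component:
  fixes f :: "'b \<Rightarrow> real"
  assumes "finite A" "x \<in> A"
  shows "measure_pmf.expectation (Pi_pmf A d p) (\<lambda>T. f (T x)) = measure_pmf.expectation (p x) f"
  using arg_cong[OF Pi_pmf_component[OF assms(1), of x d p],
      where f = "\<lambda>Q. measure_pmf.expectation Q f"] assms(2) by simp

lemma finite_set_Pi_pmf:
  assumes "finite A" "\<And>x. x \<in> A \<Longrightarrow> finite (set_pmf (p x))"
  shows "finite (set_pmf (Pi_pmf A d p))"
  using assms by (auto simp: set_Pi_pmf)

text \<open>Variances of independent centred terms add. The induction splits off one coordinate; its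
  product with the remaining sum has mean 0, so only the squares survive.\<close>

lemma expectation_Pi_pmf_sum_square:
  fixes g :: "'a \<Rightarrow> 'b \<Rightarrow> real"
  assumes "finite A" "\<And>x. x \<in> A \<Longrightarrow> finite (set_pmf (p x))"
    "\<And>x. x \<in> A \<Longrightarrow> measure_pmf.expectation (p x) (g x) = 0"
  shows "measure_pmf.expectation (Pi_pmf A d p) (\<lambda>T. (\<Sum>x\<in>A. g x (T x))\<^sup>2) =
    (\<Sum>x\<in>A. measure_pmf.expectation (p x) (\<lambda>v. (g x v)\<^sup>2))"
  using assms
proof (induction A rule: finite_induct)
  case (insert x A)
  let ?Q = "Pi_pmf A d p" and ?S = "\<lambda>T. \<Sum>z\<in>A. g z (T z)"
  have fin: "finite (set_pmf (p x))" "finite (set_pmf ?Q)"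
    using insert by (auto intro!: finite_set_Pi_pmf)
  note [intro!] = integrable_measure_pmf_finite[OF fin(1)] integrable_measure_pmf_finite[OF fin(2)]
  have S0: "measure_pmf.expectation ?Q ?S = 0"
    using insert by (subst Bochner_Integration.integral_sum)
      (auto simp: expectation_Pi_pmf_component intro!: sum.neutral)
  have upd: "(\<Sum>z\<in>insert x A. g z ((T(x := v)) z)) = g x v + ?S T" for v T
  proof -
    have "?S (T(x := v)) = ?S T" using insert(2) by (intro sum.cong) auto
    then show ?thesis using insert(1,2) by simp
  qed
  have "measure_pmf.expectation (Pi_pmf (insert x A) d p) (\<lambda>T. (\<Sum>z\<in>insert x A. g z (T z))\<^sup>2) =
      measure_pmf.expectation (p x) (\<lambda>v. measure_pmf.expectation ?Q (\<lambda>T. (g x v + ?S T)\<^sup>2))"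
    using insert(1,2) fin
    by (simp add: Pi_pmf_insert' expectation_bind_pmf_finite upd del: fun_upd_apply sum.insert)
  also have "\<dots> = measure_pmf.expectation (p x)
      (\<lambda>v. (g x v)\<^sup>2 + measure_pmf.expectation ?Q (\<lambda>T. (?S T)\<^sup>2))"
  proof (rule Bochner_Integration.integral_cong[OF refl])
    fix v
    have "measure_pmf.expectation ?Q (\<lambda>T. (g x v + ?S T)\<^sup>2) =
        measure_pmf.expectation ?Q (\<lambda>T. (g x v)\<^sup>2 + (?S T)\<^sup>2 + 2 * g x v * ?S T)"
      by (simp add: power2_sum)
    also have "\<dots> = (g x v)\<^sup>2 + measure_pmf.expectation ?Q (\<lambda>T. (?S T)\<^sup>2) +
        2 * g x v * measure_pmf.expectation ?Q ?S"
      by (subst Bochner_Integration.integral_add Bochner_Integration.integral_mult_right_zero; auto)+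
    finally show "measure_pmf.expectation ?Q (\<lambda>T. (g x v + ?S T)\<^sup>2) =
        (g x v)\<^sup>2 + measure_pmf.expectation ?Q (\<lambda>T. (?S T)\<^sup>2)" using S0 by simp
  qed
  also have "\<dots> = measure_pmf.expectation (p x) (\<lambda>v. (g x v)\<^sup>2) +
      measure_pmf.expectation ?Q (\<lambda>T. (?S T)\<^sup>2)"
    by (subst Bochner_Integration.integral_add) auto
  finally show ?case using insert by simp
qed simp

lemma finite_abs_bound:
  fixes f :: "'b \<Rightarrow> real"
  assumes "finite V"
  obtains B where "\<And>v. v \<in> V \<Longrightarrow> \<bar>f v\<bar> \<le> B"
  using assms that[of "Max ((\<lambda>v. \<bar>f v\<bar>) ` V)"] by auto

section \<open>Averages and mean square convergence\<close>

definition average :: "nat \<Rightarrow> ('b \<Rightarrow> real) \<Rightarrow> (nat \<Rightarrow> 'b) \<Rightarrow> real" where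
  "average m f T = (\<Sum>j<m. f (T j)) / real m"

text \<open>Mean square convergence is the invariant of the induction because it can be bounded
  conditionally on the previous stage and then averaged; it yields both convergence in probability
  and convergence of means.\<close>

definition mean_square_limit :: "(nat \<Rightarrow> 'o pmf) \<Rightarrow> (nat \<Rightarrow> 'o \<Rightarrow> real) \<Rightarrow> real \<Rightarrow> bool" where
  "mean_square_limit P F c \<longleftrightarrow>
     (\<lambda>m. measure_pmf.expectation (P m) (\<lambda>\<omega>. (F m \<omega> - c)\<^sup>2)) \<longlonglongrightarrow> 0"

lemma average_cong:
  assumes "\<And>j. j < m \<Longrightarrow> f (S j) = g (T j)"
  shows "average m f S = average m g T"
  unfolding average_def using assms by (auto intro!: sum.cong)

text \<open>Bias and variance of an average of independent terms: \<open>B\<^sup>2 / m\<close>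
  bounds the variance, and the last term is the squared bias.\<close>

lemma average_Pi_pmf_mean_square:
  fixes f :: "'b \<Rightarrow> real"
  assumes fin: "\<And>j. j < m \<Longrightarrow> finite (set_pmf (p j))"
    and B: "\<And>j v. j < m \<Longrightarrow> v \<in> set_pmf (p j) \<Longrightarrow> \<bar>f v\<bar> \<le> B"
  shows "measure_pmf.expectation (Pi_pmf {..<m} d p) (\<lambda>T. (average m f T - c)\<^sup>2) \<le>
    B\<^sup>2 / m + ((\<Sum>j<m. measure_pmf.expectation (p j) f) / m - c)\<^sup>2"
proof -
  let ?Q = "Pi_pmf {..<m} d p"
  define e where "e = (\<lambda>j. measure_pmf.expectation (p j) f)"
  define D where "D = (\<Sum>j<m. e j) / m - c"
  define G where "G = (\<lambda>T. \<Sum>j<m. f (T j) - e j)"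
  have finQ: "finite (set_pmf ?Q)" using fin by (intro finite_set_Pi_pmf) auto
  note [intro!] = integrable_measure_pmf_finite[OF finQ] integrable_measure_pmf_finite[OF fin]
  have centred: "measure_pmf.expectation (p j) (\<lambda>v. f v - e j) = 0" if "j < m" for j
    using that by (subst Bochner_Integration.integral_diff) (auto simp: e_def)
  have G0: "measure_pmf.expectation ?Q G = 0"
    unfolding G_def using centred
    by (subst Bochner_Integration.integral_sum)
      (auto simp: expectation_Pi_pmf_component[where f = "\<lambda>v. f v - e j" for j] intro!: sum.neutral)
  have "measure_pmf.expectation (p j) (\<lambda>v. (f v - e j)\<^sup>2) \<le> B\<^sup>2" if j: "j < m" for j
  proof -
    have "measure_pmf.expectation (p j) (\<lambda>v. (f v - e j)\<^sup>2) =
        measure_pmf.expectation (p j) (\<lambda>v. (f v)\<^sup>2 + (e j)\<^sup>2 - 2 * e j * f v)"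
      by (simp add: power2_diff mult_ac)
    also have "\<dots> = measure_pmf.expectation (p j) (\<lambda>v. (f v)\<^sup>2) + (e j)\<^sup>2 - 2 * e j * e j"
      using j by (subst Bochner_Integration.integral_diff Bochner_Integration.integral_add
          Bochner_Integration.integral_mult_right_zero; auto simp: e_def)+
    also have "\<dots> \<le> measure_pmf.expectation (p j) (\<lambda>v. (f v)\<^sup>2)"
      by (simp add: power2_eq_square)
    also have "\<dots> \<le> measure_pmf.expectation (p j) (\<lambda>v. B\<^sup>2)"
      using B[OF j] fin[OF j] by (intro expectation_mono_pmf) (auto simp: abs_le_square_iff[symmetric] intro: order_trans[OF _ abs_ge_self])
    finally show ?thesis by simp
  qed
  then have GG: "measure_pmf.expectation ?Q (\<lambda>T. (G T)\<^sup>2) \<le> m * B\<^sup>2"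
    unfolding G_def using fin centred
    by (subst expectation_Pi_pmf_sum_square[where g = "\<lambda>j v. f v - e j"])
      (auto intro!: order_trans[OF sum_bounded_above])
  \<comment> \<open>\<open>G T / m\<close> is the fluctuation, of mean 0, and \<open>D\<close> is
    the deterministic bias, so the cross term drops out of the mean square.\<close>
  have split: "average m f T - c = G T / m + D" for T
    by (simp add: average_def D_def G_def sum_subtractf diff_divide_distrib)
  have "measure_pmf.expectation ?Q (\<lambda>T. (average m f T - c)\<^sup>2) =
      measure_pmf.expectation ?Q (\<lambda>T. (G T)\<^sup>2 / m\<^sup>2 + D\<^sup>2 + 2 * D / m * G T)"
    by (simp add: split power2_sum power_divide mult_ac)
  also have "\<dots> = measure_pmf.expectation ?Q (\<lambda>T. (G T)\<^sup>2) / m\<^sup>2 + D\<^sup>2"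
    using G0 by (subst Bochner_Integration.integral_add Bochner_Integration.integral_mult_right_zero; auto)+
  also have "\<dots> \<le> (m * B\<^sup>2) / m\<^sup>2 + D\<^sup>2"
    using GG by (intro add_right_mono divide_right_mono) auto
  also have "(m * B\<^sup>2) / m\<^sup>2 = B\<^sup>2 / m" by (simp add: power2_eq_square)
  finally show ?thesis by (simp add: D_def e_def)
qed

lemma mean_square_limit_bind:
  assumes fin: "\<And>m. finite (set_pmf (P m))"
    "\<And>m S. S \<in> set_pmf (P m) \<Longrightarrow> finite (set_pmf (K m S))"
    and R: "(\<lambda>m. measure_pmf.expectation (P m) (R m)) \<longlonglongrightarrow> 0"
    and le: "\<And>m S. S \<in> set_pmf (P m) \<Longrightarrow>
      measure_pmf.expectation (K m S) (\<lambda>T. (F m T - c)\<^sup>2) \<le> B / real m + R m S"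
  shows "mean_square_limit (\<lambda>m. P m \<bind> K m) F c"
  unfolding mean_square_limit_def
proof (rule tendsto_sandwich[where f = "\<lambda>_. 0", OF _ _ tendsto_const])
  have "(\<lambda>m. B / real m + measure_pmf.expectation (P m) (R m)) \<longlonglongrightarrow> 0 + 0"
    by (intro tendsto_add R lim_const_over_n)
  then show "(\<lambda>m. B / real m + measure_pmf.expectation (P m) (R m)) \<longlonglongrightarrow> 0" by simp
  show "\<forall>\<^sub>F m in sequentially. measure_pmf.expectation (P m \<bind> K m) (\<lambda>T. (F m T - c)\<^sup>2)
      \<le> B / real m + measure_pmf.expectation (P m) (R m)"
  proof (intro always_eventually allI)
    fix m
    have "measure_pmf.expectation (P m \<bind> K m) (\<lambda>T. (F m T - c)\<^sup>2) =
        measure_pmf.expectation (P m) (\<lambda>S. measure_pmf.expectation (K m S) (\<lambda>T. (F m T - c)\<^sup>2))"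
      by (intro expectation_bind_pmf_finite fin)
    also have "\<dots> \<le> measure_pmf.expectation (P m) (\<lambda>S. B / real m + R m S)"
      by (intro expectation_mono_pmf fin le)
    also have "\<dots> = B / real m + measure_pmf.expectation (P m) (R m)"
      by (subst Bochner_Integration.integral_add) (auto intro!: integrable_measure_pmf_finite fin)
    finally show "measure_pmf.expectation (P m \<bind> K m) (\<lambda>T. (F m T - c)\<^sup>2)
      \<le> B / real m + measure_pmf.expectation (P m) (R m)" .
  qed
qed (auto intro!: expectation_nonneg_pmf)

text \<open>Given \<open>X\<close> the draws are independent, and the mean of the new average of
  \<open>f\<close> is the old average of \<open>g\<close>. The added noise is at most
  \<open>B\<^sup>2 / m\<close>, with one bound \<open>B\<close> for all sample sizes.\<close>

lemma mean_square_limit_kernel: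
  fixes f :: "'b \<Rightarrow> real"
  assumes fin: "\<And>m. finite (set_pmf (P m))"
    and lim: "mean_square_limit P (\<lambda>m. average m g) c"
    and kfin: "\<And>m X j. X \<in> set_pmf (P m) \<Longrightarrow> j < m \<Longrightarrow> finite (set_pmf (k (X j)))"
    and B: "\<And>m X j v. X \<in> set_pmf (P m) \<Longrightarrow> j < m \<Longrightarrow> v \<in> set_pmf (k (X j)) \<Longrightarrow> \<bar>f v\<bar> \<le> B"
    and g: "\<And>m X j. X \<in> set_pmf (P m) \<Longrightarrow> j < m \<Longrightarrow> measure_pmf.expectation (k (X j)) f = g (X j)"
  shows "mean_square_limit (\<lambda>m. P m \<bind> (\<lambda>X. Pi_pmf {..<m} d (\<lambda>j. k (X j)))) (\<lambda>m. average m f) c"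
proof (rule mean_square_limit_bind[where B = "B\<^sup>2" and R = "\<lambda>m X. (average m g X - c)\<^sup>2"])
  show "(\<lambda>m. measure_pmf.expectation (P m) (\<lambda>X. (average m g X - c)\<^sup>2)) \<longlonglongrightarrow> 0"
    using lim by (simp add: mean_square_limit_def)
  fix m X assume X: "X \<in> set_pmf (P m)"
  show "finite (set_pmf (Pi_pmf {..<m} d (\<lambda>j. k (X j))))"
    using X kfin by (intro finite_set_Pi_pmf) auto
  show "measure_pmf.expectation (Pi_pmf {..<m} d (\<lambda>j. k (X j))) (\<lambda>T. (average m f T - c)\<^sup>2)
      \<le> B\<^sup>2 / real m + (average m g X - c)\<^sup>2"
    using average_Pi_pmf_mean_square[of m "\<lambda>j. k (X j)" f B d c] X kfin B g
    by (simp add: average_def)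
qed (rule fin)

lemma mean_square_limit_map:
  "mean_square_limit (\<lambda>m. map_pmf (\<phi> m) (P m)) F c = mean_square_limit P (\<lambda>m S. F m (\<phi> m S)) c"
  by (simp add: mean_square_limit_def)

text \<open>A variance is nonnegative, so the squared distance of the mean from \<open>c\<close> is
  at most the mean square distance.\<close>

lemma mean_square_limit_expectation:
  assumes fin: "\<And>m. finite (set_pmf (P m))" and lim: "mean_square_limit P F c"
  shows "(\<lambda>m. measure_pmf.expectation (P m) (F m)) \<longlonglongrightarrow> c"
proof -
  have "(\<lambda>m. measure_pmf.expectation (P m) (F m) - c) \<longlonglongrightarrow> 0"
  proof (rule Lim_null_comparison)
    have "(\<lambda>m. sqrt (measure_pmf.expectation (P m) (\<lambda>S. (F m S - c)\<^sup>2))) \<longlonglongrightarrow> sqrt 0"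
      using lim unfolding mean_square_limit_def by (rule tendsto_real_sqrt)
    then show "(\<lambda>m. sqrt (measure_pmf.expectation (P m) (\<lambda>S. (F m S - c)\<^sup>2))) \<longlonglongrightarrow> 0" by simp
    show "\<forall>\<^sub>F m in sequentially. norm (measure_pmf.expectation (P m) (F m) - c)
        \<le> sqrt (measure_pmf.expectation (P m) (\<lambda>S. (F m S - c)\<^sup>2))"
    proof (intro always_eventually allI)
      fix m
      note int [intro!] = integrable_measure_pmf_finite[OF fin[of m]]
      have "(measure_pmf.expectation (P m) (\<lambda>S. F m S - c))\<^sup>2
          \<le> measure_pmf.expectation (P m) (\<lambda>S. (F m S - c)\<^sup>2)"
        using measure_pmf.variance_positive[of "P m" "\<lambda>S. F m S - c"]
        by (subst (asm) measure_pmf.variance_eq) auto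
      moreover have "measure_pmf.expectation (P m) (\<lambda>S. F m S - c) = measure_pmf.expectation (P m) (F m) - c"
        by (subst Bochner_Integration.integral_diff) auto
      ultimately show "norm (measure_pmf.expectation (P m) (F m) - c)
          \<le> sqrt (measure_pmf.expectation (P m) (\<lambda>S. (F m S - c)\<^sup>2))"
        by (auto intro!: real_le_rsqrt)
    qed
  qed
  then show ?thesis by (simp add: LIM_zero_iff)
qed

text \<open>Chebyshev's inequality.\<close>

lemma mean_square_limit_prob:
  assumes fin: "\<And>m. finite (set_pmf (P m))" and lim: "mean_square_limit P F c" and e: "\<epsilon> > 0"
  shows "(\<lambda>m. measure_pmf.prob (P m) {S. \<epsilon> \<le> \<bar>F m S - c\<bar>}) \<longlonglongrightarrow> 0"
proof (rule tendsto_sandwich[where f = "\<lambda>_. 0", OF _ _ tendsto_const])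
  have "(\<lambda>m. measure_pmf.expectation (P m) (\<lambda>S. (F m S - c)\<^sup>2) / \<epsilon>\<^sup>2) \<longlonglongrightarrow> 0 / \<epsilon>\<^sup>2"
    using lim e unfolding mean_square_limit_def by (intro tendsto_divide) auto
  then show "(\<lambda>m. measure_pmf.expectation (P m) (\<lambda>S. (F m S - c)\<^sup>2) / \<epsilon>\<^sup>2) \<longlonglongrightarrow> 0" by simp
  show "\<forall>\<^sub>F m in sequentially. measure_pmf.prob (P m) {S. \<epsilon> \<le> \<bar>F m S - c\<bar>}
      \<le> measure_pmf.expectation (P m) (\<lambda>S. (F m S - c)\<^sup>2) / \<epsilon>\<^sup>2"
    using measure_pmf.second_moment_method[OF _ _ e, of "\<lambda>S. F m S - c" "P m" for m]
    by (auto intro!: always_eventually integrable_measure_pmf_finite fin)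
qed auto

text \<open>If \<open>D\<close> is within 1/2 of 1, it exceeds 1/2, and then an error of \<epsilon>
  in the ratio forces \<open>N - \<theta> * D\<close> to have size at least \<epsilon>/2. The value
  of the ratio at \<open>D = 0\<close> falls into the other, asymptotically negligible
  event.\<close>

lemma consistent_ratio:
  assumes fin: "\<And>m. finite (set_pmf (P m))"
    and num: "mean_square_limit P (\<lambda>m S. N m S - \<theta> * D m S) 0"
    and den: "mean_square_limit P D 1"
  shows "consistent_estimator P (\<lambda>m S. N m S / D m S) \<theta>"
  unfolding consistent_estimator_def
proof (intro allI impI)
  fix \<epsilon> :: real assume e: "\<epsilon> > 0"
  let ?A = "\<lambda>m. {S. \<epsilon> / 2 \<le> \<bar>N m S - \<theta> * D m S - 0\<bar>}" and ?B = "\<lambda>m. {S. 1 / 2 \<le> \<bar>D m S - 1\<bar>}"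
  have sub: "{S. \<epsilon> \<le> \<bar>N m S / D m S - \<theta>\<bar>} \<subseteq> ?A m \<union> ?B m" for m
  proof (rule subsetI, rule ccontr)
    fix S assume S: "S \<in> {S. \<epsilon> \<le> \<bar>N m S / D m S - \<theta>\<bar>}" "S \<notin> ?A m \<union> ?B m"
    then have D: "D m S > 1 / 2" by (auto simp: abs_if split: if_splits)
    then have "\<bar>N m S / D m S - \<theta>\<bar> * D m S = \<bar>(N m S / D m S - \<theta>) * D m S\<bar>"
      by (simp add: abs_mult)
    also have "\<dots> = \<bar>N m S - \<theta> * D m S\<bar>"
      using D by (simp add: left_diff_distrib)
    also have "\<dots> < \<epsilon> * (1 / 2)" using S by auto
    also have "\<dots> \<le> \<bar>N m S / D m S - \<theta>\<bar> * D m S"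
      using S D e by (intro mult_mono) auto
    finally show False by simp
  qed
  show "(\<lambda>m. measure_pmf.prob (P m) {S. \<epsilon> \<le> \<bar>N m S / D m S - \<theta>\<bar>}) \<longlonglongrightarrow> 0"
  proof (rule tendsto_sandwich[where f = "\<lambda>_. 0", OF _ _ tendsto_const])
    have "(\<lambda>m. measure_pmf.prob (P m) (?A m) + measure_pmf.prob (P m) (?B m)) \<longlonglongrightarrow> 0 + 0"
      using e by (intro tendsto_add mean_square_limit_prob[OF fin num] mean_square_limit_prob[OF fin den]) auto
    then show "(\<lambda>m. measure_pmf.prob (P m) (?A m) + measure_pmf.prob (P m) (?B m)) \<longlonglongrightarrow> 0" by simp
    show "\<forall>\<^sub>F m in sequentially. measure_pmf.prob (P m) {S. \<epsilon> \<le> \<bar>N m S / D m S - \<theta>\<bar>}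
        \<le> measure_pmf.prob (P m) (?A m) + measure_pmf.prob (P m) (?B m)"
      by (intro always_eventually allI order_trans[OF measure_pmf.finite_measure_mono[OF sub] measure_Un_le])
        auto
  qed auto
qed

section \<open>Sums over paths\<close>

abbreviation paths :: "nat \<Rightarrow> 'a list set" where
  "paths n \<equiv> {xs. length xs = n}"

lemma finite_paths [simp]: "finite (paths n :: 'a::finite list set)"
  using finite_lists_length_eq[of "UNIV :: 'a set" n] by simp

lemma sum_paths_append:
  fixes f :: "'a::finite list \<Rightarrow> 'b::comm_monoid_add"
  shows "(\<Sum>xs\<in>paths (m + n). f xs) = (\<Sum>xs\<in>paths m. \<Sum>z\<in>paths n. f (xs @ z))"
proof -
  have "(\<Sum>xs\<in>paths m. \<Sum>z\<in>paths n. f (xs @ z)) = (\<Sum>(xs, z)\<in>paths m \<times> paths n. f (xs @ z))"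
    by (rule sum.cartesian_product)
  also have "\<dots> = (\<Sum>xs\<in>paths (m + n). f xs)"
    by (rule sum.reindex_bij_witness[where i = "\<lambda>xs. (take m xs, drop m xs)"
          and j = "\<lambda>(xs, z). xs @ z"]) auto
  finally show ?thesis ..
qed

lemma sum_paths_Suc_0:
  fixes f :: "'a::finite list \<Rightarrow> 'b::comm_monoid_add"
  shows "(\<Sum>xs\<in>paths (Suc 0). f xs) = (\<Sum>a\<in>UNIV. f [a])"
  by (rule sum.reindex_bij_witness[where i = "\<lambda>a. [a]" and j = hd]) (auto simp: length_Suc_conv)

section \<open>One step of the algorithm\<close>

lemma set_pmf_pilot: "z \<in> set_pmf (pilot q n xs) \<Longrightarrow> length z = n \<and> pilot_density q xs z > 0"
  using pmf_pilot[of q n xs z] pmf_pos[of "pilot q n xs" z]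
  by (auto simp: set_pmf_iff less_le split: if_splits)

lemma finite_set_pilot: "finite (set_pmf (pilot q n (xs :: 'a::finite list)))"
  by (rule finite_subset[OF _ finite_paths[of n]]) (use set_pmf_pilot in blast)

lemma pilot_density_nonneg: "0 \<le> pilot_density q xs z"
  by (simp add: pilot_density_def prod_nonneg)

lemma U_nonneg: "0 \<le> U \<pi> \<Delta> q t xs zs a"
  by (simp add: U_def pilot_density_nonneg)

lemma trial_prob_nonneg: "0 \<le> trial_prob \<pi> \<Delta> q t xs zs a"
  by (simp add: trial_prob_def U_nonneg sum_nonneg)

lemma pmf_trial:
  fixes \<pi> :: "nat \<Rightarrow> 'a::finite list pmf"
  assumes "(\<Sum>a\<in>UNIV. U \<pi> \<Delta> q t xs zs a) \<noteq> 0"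
  shows "pmf (embed_pmf (trial_prob \<pi> \<Delta> q t xs zs)) a = trial_prob \<pi> \<Delta> q t xs zs a"
proof (rule pmf_embed_pmf)
  have "(\<Sum>a\<in>UNIV. trial_prob \<pi> \<Delta> q t xs zs a) = 1"
    using assms by (simp add: trial_prob_def flip: sum_divide_distrib)
  then show "(\<integral>\<^sup>+ a. ennreal (trial_prob \<pi> \<Delta> q t xs zs a) \<partial>count_space UNIV) = 1"
    by (simp add: nn_integral_count_space_finite trial_prob_nonneg)
qed (rule trial_prob_nonneg)

text \<open>States range over a finite type and pilots have a fixed length, so the support is finite
  even where the law of \<open>cur\<close> is unspecified.\<close>

lemma finite_set_step: "finite (set_pmf (step \<pi> \<Delta> q t (p :: 'a::finite list \<times> real)))"
  unfolding step_def
  by (auto intro!: finite_set_Pi_pmf finite_set_pilot)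

lemma set_pmf_step:
  assumes "d \<in> set_pmf (step \<pi> \<Delta> q t p)"
  shows "past d = fst p" "past_wgt d = snd p"
  using assms by (auto simp: step_def)

text \<open>A step only carries the weight along, so it may be run with weight 1 and the true weight
  inserted afterwards.\<close>

lemma step_scale:
  "step \<pi> \<Delta> q t p = map_pmf (past_wgt_update (\<lambda>_. snd p)) (step \<pi> \<Delta> q t (fst p, 1))"
  by (simp add: step_def map_bind_pmf)

text \<open>Conditioning on the input replaces the test function \<open>h\<close> by
  \<open>G h\<close>, to which the proper weighting of the input applies. The ordinary and the
  auxiliary weights are both instances.\<close>

lemma properly_weighted_step:
  fixes D :: "('a::finite list \<times> real) pmf"
  assumes D: "properly_weighted D \<rho>" and \<rho>: "finite (set_pmf \<rho>)"
    and W: "\<And>d w. W (past_wgt_update (\<lambda>_. w) d) = w * V d"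
    and X: "\<And>d w. X (past_wgt_update (\<lambda>_. w) d) = X d"
    and exp: "\<And>p h. p \<in> set_pmf D \<Longrightarrow>
      measure_pmf.expectation (step \<pi> \<Delta> q t p) (\<lambda>d. W d * h (X d)) = snd p * G h (fst p)"
    and G: "\<And>h. measure_pmf.expectation \<rho> (G h) = measure_pmf.expectation \<tau> h"
  shows "properly_weighted (map_pmf (\<lambda>d. (X d, W d)) (D \<bind> step \<pi> \<Delta> q t)) \<tau>"
  unfolding properly_weighted_def
proof (intro allI impI)
  fix h
  \<comment> \<open>\<open>H\<close> is a function of the path alone. As \<rho> has finite support,
    \<open>H\<close> is integrable under \<rho>, and the proper weighting of \<open>D\<close> then
    supplies the integrability needed for the two-stage draw.\<close>
  define H where "H = (\<lambda>xs. measure_pmf.expectation (step \<pi> \<Delta> q t (xs, 1)) (\<lambda>d. \<bar>V d * h (X d)\<bar>))"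
  have int: "integrable (measure_pmf D) (\<lambda>p. snd p * g (fst p))"
    and exp': "measure_pmf.expectation D (\<lambda>p. snd p * g (fst p)) = measure_pmf.expectation \<rho> g" for g
    using D \<rho> by (auto simp: properly_weighted_def case_prod_unfold integrable_measure_pmf_finite)
  have "measure_pmf.expectation (step \<pi> \<Delta> q t p) (\<lambda>d. \<bar>W d * h (X d)\<bar>) = \<bar>snd p\<bar> * H (fst p)" for p
    by (subst step_scale) (simp add: W X H_def abs_mult mult.assoc)
  moreover have "\<bar>snd p\<bar> * H (fst p) = \<bar>snd p * H (fst p)\<bar>" for p :: "'a list \<times> real"
    by (simp add: H_def abs_mult expectation_nonneg_pmf)
  ultimately have
    "integrable (measure_pmf D) (\<lambda>p. measure_pmf.expectation (step \<pi> \<Delta> q t p) (\<lambda>d. \<bar>W d * h (X d)\<bar>))"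
    using int[of H] by simp
  then have "has_bochner_integral (measure_pmf (D \<bind> step \<pi> \<Delta> q t)) (\<lambda>d. W d * h (X d))
      (measure_pmf.expectation D (\<lambda>p. measure_pmf.expectation (step \<pi> \<Delta> q t p) (\<lambda>d. W d * h (X d))))"
    by (rule bind_pmf_expectation[OF integrable_measure_pmf_finite[OF finite_set_step]])
  moreover have "measure_pmf.expectation D
      (\<lambda>p. measure_pmf.expectation (step \<pi> \<Delta> q t p) (\<lambda>d. W d * h (X d))) = measure_pmf.expectation \<tau> h"
    by (subst G[symmetric], subst exp'[symmetric]) (intro expectation_cong_pmf exp)
  ultimately show "integrable (map_pmf (\<lambda>d. (X d, W d)) (D \<bind> step \<pi> \<Delta> q t)) (\<lambda>(x, w). w * h x) \<and>
      measure_pmf.expectation (map_pmf (\<lambda>d. (X d, W d)) (D \<bind> step \<pi> \<Delta> q t)) (\<lambda>(x, w). w * h x) =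
      measure_pmf.expectation \<tau> h"
    by (simp add: has_bochner_integral_iff)
qed

text \<open>Of the posteriors, only the lengths of possible paths and the nesting of supports are
  kept. The three coverage assumptions ensure that a trial probability or density vanishes only
  where its target does.\<close>

locale lookahead_setting =
  fixes \<pi> :: "nat \<Rightarrow> 'a::finite list pmf" and \<Delta> :: nat
    and q0 :: "'a pmf" and q :: "nat \<Rightarrow> 'a list \<Rightarrow> 'a pmf"
  assumes target_length: "\<And>s xs. pmf (\<pi> s) xs > 0 \<Longrightarrow> length xs = Suc s"
    and target_prefix: "\<And>s n xs z. length xs = Suc s \<Longrightarrow> pmf (\<pi> (s + n)) (xs @ z) > 0 \<Longrightarrow> pmf (\<pi> s) xs > 0"
    and q0_covers: "\<And>x. pmf (\<pi> 0) [x] > 0 \<Longrightarrow> pmf q0 x > 0"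
    and pilot_covers: "\<And>s xs z. length xs = s + 1 \<Longrightarrow> length z = \<Delta> \<Longrightarrow>
          pmf (\<pi> (s + \<Delta>)) (xs @ z) > 0 \<Longrightarrow> pilot_density q xs z > 0"
    and trial_covers: "\<And>s xs zs a. s \<ge> 1 \<Longrightarrow> length xs = s \<Longrightarrow>
          (\<And>b. zs b \<in> set_pmf (pilot q \<Delta> (xs @ [b]))) \<Longrightarrow>
          pmf (\<pi> s) (xs @ [a]) > 0 \<Longrightarrow> trial_prob \<pi> \<Delta> q s xs zs a > 0"
begin

lemma length_target: "xs \<in> set_pmf (\<pi> s) \<Longrightarrow> length xs = Suc s"
  by (rule target_length) (rule pmf_positive)

lemma finite_target: "finite (set_pmf (\<pi> s))"
  by (rule finite_subset[OF _ finite_paths[of "Suc s"]]) (auto dest: length_target)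

lemma target_expectation: "measure_pmf.expectation (\<pi> s) h = (\<Sum>xs\<in>paths (Suc s). pmf (\<pi> s) xs * h xs)"
  by (subst integral_measure_pmf_real[where A = "paths (Suc s)"])
    (auto dest: length_target simp: mult.commute)

text \<open>Under \<open>\<pi> (t + n)\<close>, \<open>predictive n t h xs\<close> is the conditional expectation of \<open>h (x_0, ..., x_t)\<close>
  given \<open>(x_0, ..., x_{t-1}) = xs\<close>, times the ratio of the probabilities of \<open>xs\<close> under \<open>\<pi> (t + n)\<close>
  and \<open>\<pi> (t - 1)\<close>.\<close>

definition predictive :: "nat \<Rightarrow> nat \<Rightarrow> ('a list \<Rightarrow> real) \<Rightarrow> 'a list \<Rightarrow> real" where
  "predictive n t h xs =
     (\<Sum>a\<in>UNIV. (\<Sum>z\<in>paths n. pmf (\<pi> (t + n)) (xs @ [a] @ z) / pmf (\<pi> (t - 1)) xs) * h (xs @ [a]))"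

text \<open>Weighting by \<open>pmf (\<pi> (t - 1)) xs\<close> cancels the denominator; summing over
  the past, the new state and \<open>n\<close> further states is then summing over whole
  paths.\<close>

lemma expectation_predictive:
  assumes t: "t \<ge> 1"
  shows "measure_pmf.expectation (\<pi> (t - 1)) (predictive n t h) =
    measure_pmf.expectation (prefix_law \<pi> (t + n) t) h"
proof -
  have Suc_t: "Suc (t - 1) = t" using t by simp
  \<comment> \<open>If the denominator is 0, \<open>target_prefix\<close> forces the numerator to be
    0 too. It is used with \<open>Suc n\<close> because \<open>z\<close> holds the state at time
    \<open>t\<close> as well as the \<open>n\<close> states after it.\<close>
  have cancel: "pmf (\<pi> (t - 1)) xs * (r / pmf (\<pi> (t - 1)) xs) = r"
    if "length xs = t" "r = pmf (\<pi> (t + n)) (xs @ z)" for xs z and r :: real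
    using target_prefix[of xs "t - 1" "Suc n" z] that t pmf_pos[of "\<pi> (t + n)" "xs @ z"]
    by (cases "r = 0") auto
  have "measure_pmf.expectation (\<pi> (t - 1)) (predictive n t h) =
      (\<Sum>xs\<in>paths t. \<Sum>a\<in>UNIV. \<Sum>z\<in>paths n. pmf (\<pi> (t - 1)) xs *
        (pmf (\<pi> (t + n)) (xs @ [a] @ z) / pmf (\<pi> (t - 1)) xs) * h (xs @ [a]))"
    by (simp only: target_expectation Suc_t predictive_def sum_distrib_left sum_distrib_right mult.assoc)
  also have "\<dots> = (\<Sum>xs\<in>paths t. \<Sum>a\<in>UNIV. \<Sum>z\<in>paths n. pmf (\<pi> (t + n)) (xs @ [a] @ z) * h (xs @ [a]))"
    by (intro sum.cong refl, subst cancel) auto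
  also have "\<dots> = (\<Sum>xs\<in>paths (t + Suc 0). \<Sum>z\<in>paths n. pmf (\<pi> (t + n)) (xs @ z) * h xs)"
    by (simp only: sum_paths_append sum_paths_Suc_0 append_assoc)
  also have "\<dots> = (\<Sum>xs\<in>paths (t + Suc 0). \<Sum>z\<in>paths n.
      pmf (\<pi> (t + n)) (xs @ z) * h (take (Suc t) (xs @ z)))"
    by (intro sum.cong refl) simp
  also have "\<dots> = (\<Sum>xs\<in>paths (t + Suc 0 + n). pmf (\<pi> (t + n)) xs * h (take (Suc t) xs))"
    by (simp only: sum_paths_append)
  also have "\<dots> = measure_pmf.expectation (prefix_law \<pi> (t + n) t) h"
    by (simp add: prefix_law_def target_expectation)
  finally show ?thesis .
qed

text \<open>Importance sampling: the pilot density in the denominator of \<open>U\<close> cancels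
  against the law of the pilot. Where it vanishes, \<open>pilot_covers\<close> makes the target
  vanish.\<close>

lemma expectation_pilot_U:
  assumes t: "t \<ge> 1" and xs: "length xs = t"
  shows "measure_pmf.expectation (Pi_pmf UNIV [] (\<lambda>a. pilot q \<Delta> (xs @ [a]))) (\<lambda>zs. U \<pi> \<Delta> q t xs zs a) =
    (\<Sum>z\<in>paths \<Delta>. pmf (\<pi> (t + \<Delta>)) (xs @ [a] @ z) / pmf (\<pi> (t - 1)) xs)"
proof -
  have "measure_pmf.expectation (Pi_pmf UNIV [] (\<lambda>a. pilot q \<Delta> (xs @ [a]))) (\<lambda>zs. U \<pi> \<Delta> q t xs zs a) =
      measure_pmf.expectation (pilot q \<Delta> (xs @ [a])) (\<lambda>z. pmf (\<pi> (t + \<Delta>)) (xs @ [a] @ z) /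
        (pmf (\<pi> (t - 1)) xs * pilot_density q (xs @ [a]) z))"
    unfolding U_def by (subst expectation_Pi_pmf_component) auto
  also have "\<dots> = (\<Sum>z\<in>paths \<Delta>. pmf (\<pi> (t + \<Delta>)) (xs @ [a] @ z) /
        (pmf (\<pi> (t - 1)) xs * pilot_density q (xs @ [a]) z) * pilot_density q (xs @ [a]) z)"
    by (subst integral_measure_pmf_real[OF finite_paths[of \<Delta>]]) (auto simp: pmf_pilot dest: set_pmf_pilot)
  also have "\<dots> = (\<Sum>z\<in>paths \<Delta>. pmf (\<pi> (t + \<Delta>)) (xs @ [a] @ z) / pmf (\<pi> (t - 1)) xs)"
  proof (intro sum.cong refl)
    fix z :: "'a list" assume z: "z \<in> paths \<Delta>"
    show "pmf (\<pi> (t + \<Delta>)) (xs @ [a] @ z) / (pmf (\<pi> (t - 1)) xs * pilot_density q (xs @ [a]) z) *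
        pilot_density q (xs @ [a]) z = pmf (\<pi> (t + \<Delta>)) (xs @ [a] @ z) / pmf (\<pi> (t - 1)) xs"
      using pilot_covers[of "xs @ [a]" t z] z xs pmf_pos[of "\<pi> (t + \<Delta>)" "xs @ [a] @ z"]
      by (cases "pmf (\<pi> (t + \<Delta>)) (xs @ [a] @ z) = 0") auto
  qed
  finally show ?thesis .
qed

text \<open>Common frame for the three conditional means below: average over \<open>cur\<close>
  given the pilots, which is hypothesis \<open>c\<close>, then over the pilots by linearity.
  \<open>r zs a\<close> is the contribution of the candidate state \<open>a\<close>.\<close>

lemma step_expectation:
  assumes t: "t \<ge> 1" and p: "length (fst p) = t"
    and c: "\<And>zs. (\<And>b. zs b \<in> set_pmf (pilot q \<Delta> (fst p @ [b]))) \<Longrightarrow>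
      measure_pmf.expectation (embed_pmf (trial_prob \<pi> \<Delta> q t (fst p) zs))
        (\<lambda>x. F \<lparr>past = fst p, past_wgt = snd p, pilots = zs, cur = x\<rparr>) =
      snd p * (\<Sum>a\<in>UNIV. r zs a * h (fst p @ [a]))"
  shows "measure_pmf.expectation (step \<pi> \<Delta> q t p) F =
    snd p * (\<Sum>a\<in>UNIV. measure_pmf.expectation (Pi_pmf UNIV [] (\<lambda>a. pilot q \<Delta> (fst p @ [a])))
      (\<lambda>zs. r zs a) * h (fst p @ [a]))"
proof -
  let ?P = "Pi_pmf UNIV [] (\<lambda>a. pilot q \<Delta> (fst p @ [a]))"
  have fin: "finite (set_pmf ?P)" by (intro finite_set_Pi_pmf finite_set_pilot) auto
  have "measure_pmf.expectation (step \<pi> \<Delta> q t p) F =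
      measure_pmf.expectation ?P (\<lambda>zs. measure_pmf.expectation (embed_pmf (trial_prob \<pi> \<Delta> q t (fst p) zs))
        (\<lambda>x. F \<lparr>past = fst p, past_wgt = snd p, pilots = zs, cur = x\<rparr>))"
    unfolding step_def by (simp add: expectation_bind_pmf_finite fin)
  also have "\<dots> = measure_pmf.expectation ?P (\<lambda>zs. snd p * (\<Sum>a\<in>UNIV. r zs a * h (fst p @ [a])))"
    by (intro expectation_cong_pmf c) (auto simp: set_Pi_pmf PiE_dflt_def)
  also have "\<dots> = snd p * (\<Sum>a\<in>UNIV. measure_pmf.expectation ?P (\<lambda>zs. r zs a) * h (fst p @ [a]))"
    by (simp add: Bochner_Integration.integral_sum integrable_measure_pmf_finite fin)
  finally show ?thesis .
qed

text \<open>The summand of the estimator does not involve \<open>cur\<close>. It is what the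
  auxiliary weight times \<open>h\<close> becomes after averaging over \<open>cur\<close>, whence
  the same mean as in the next lemma.\<close>

lemma expectation_step_estimator:
  assumes t: "t \<ge> 1" and p: "length (fst p) = t"
  shows "measure_pmf.expectation (step \<pi> \<Delta> q t p)
      (\<lambda>d. past_wgt d * (\<Sum>a\<in>UNIV. U_of \<pi> \<Delta> q t d a * h (past d @ [a]))) =
    snd p * predictive \<Delta> t h (fst p)"
  using p by (subst step_expectation[OF t p, where r = "U \<pi> \<Delta> q t (fst p)" and h = h])
    (auto simp: predictive_def expectation_pilot_U[OF t p])

text \<open>The total of the \<open>U\<close> in the auxiliary weight cancels the normalisation of
  \<open>trial_prob\<close>, leaving the sum of \<open>U\<close> times \<open>h\<close> over all
  candidate states.\<close>

lemma expectation_step_aux: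
  assumes t: "t \<ge> 1" and p: "length (fst p) = t"
  shows "measure_pmf.expectation (step \<pi> \<Delta> q t p)
      (\<lambda>d. aux (outcome \<pi> \<Delta> q t d) * h (hist (outcome \<pi> \<Delta> q t d))) =
    snd p * predictive \<Delta> t h (fst p)"
proof (subst step_expectation[OF t p, where r = "U \<pi> \<Delta> q t (fst p)" and h = h])
  fix zs
  let ?S = "\<Sum>a\<in>UNIV. U \<pi> \<Delta> q t (fst p) zs a"
  let ?Q = "embed_pmf (trial_prob \<pi> \<Delta> q t (fst p) zs)"
  let ?F = "\<lambda>x. let d = \<lparr>past = fst p, past_wgt = snd p, pilots = zs, cur = x\<rparr>
      in aux (outcome \<pi> \<Delta> q t d) * h (hist (outcome \<pi> \<Delta> q t d))"
  have "measure_pmf.expectation ?Q ?F = snd p * (\<Sum>a\<in>UNIV. U \<pi> \<Delta> q t (fst p) zs a * h (fst p @ [a]))"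
  proof (cases "?S = 0")
    \<comment> \<open>Nonnegative \<open>U\<close> with sum 0 all vanish, so both sides are 0
      whatever the unspecified law of \<open>cur\<close> is.\<close>
    case True
    then have "U \<pi> \<Delta> q t (fst p) zs a = 0" for a
      using sum_nonneg_eq_0_iff[of UNIV "U \<pi> \<Delta> q t (fst p) zs"] by (simp add: U_nonneg)
    then show ?thesis by (simp add: outcome_def)
  next
    case False
    have "measure_pmf.expectation ?Q ?F =
        (\<Sum>a\<in>UNIV. snd p * ?S * h (fst p @ [a]) * trial_prob \<pi> \<Delta> q t (fst p) zs a)"
      by (subst integral_measure_pmf_real[of UNIV]) (auto simp: outcome_def pmf_trial[OF False])
    also have "\<dots> = (\<Sum>a\<in>UNIV. snd p * (U \<pi> \<Delta> q t (fst p) zs a * h (fst p @ [a])))"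
      using False by (intro sum.cong) (auto simp: trial_prob_def)
    finally show ?thesis by (simp add: sum_distrib_left)
  qed
  then show "measure_pmf.expectation ?Q (\<lambda>x. aux (outcome \<pi> \<Delta> q t
        \<lparr>past = fst p, past_wgt = snd p, pilots = zs, cur = x\<rparr>) *
      h (hist (outcome \<pi> \<Delta> q t \<lparr>past = fst p, past_wgt = snd p, pilots = zs, cur = x\<rparr>))) =
      snd p * (\<Sum>a\<in>UNIV. U \<pi> \<Delta> q t (fst p) zs a * h (fst p @ [a]))"
    by (simp add: Let_def)
qed (simp add: predictive_def expectation_pilot_U[OF t p])

text \<open>Given the pilots, \<open>wgt\<close> is an ordinary importance weight against the trial
  law of \<open>cur\<close>, so the conditional mean is the same for all pilots; hence
  \<open>r\<close> ignores them and no lookahead states remain.\<close>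

lemma expectation_step_wgt:
  assumes t: "t \<ge> 1" and p: "length (fst p) = t"
  shows "measure_pmf.expectation (step \<pi> \<Delta> q t p)
      (\<lambda>d. wgt (outcome \<pi> \<Delta> q t d) * h (hist (outcome \<pi> \<Delta> q t d))) =
    snd p * predictive 0 t h (fst p)"
proof (subst step_expectation[OF t p,
      where r = "\<lambda>_ a. pmf (\<pi> t) (fst p @ [a]) / pmf (\<pi> (t - 1)) (fst p)" and h = h])
  fix zs assume zs: "\<And>b. zs b \<in> set_pmf (pilot q \<Delta> (fst p @ [b]))"
  let ?S = "\<Sum>a\<in>UNIV. U \<pi> \<Delta> q t (fst p) zs a" and ?tr = "trial_prob \<pi> \<Delta> q t (fst p) zs"
  let ?\<rho> = "\<lambda>a. pmf (\<pi> t) (fst p @ [a])" and ?\<sigma> = "pmf (\<pi> (t - 1)) (fst p)"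
  \<comment> \<open>If the trial probability is 0, \<open>trial_covers\<close> makes the target 0,
    so the cancellation survives division by zero.\<close>
  have covers: "?\<rho> a / (?\<sigma> * ?tr a) * ?tr a = ?\<rho> a / ?\<sigma>" for a
    using trial_covers[OF t p zs, of a] pmf_pos[of "\<pi> t" "fst p @ [a]"] by (cases "?\<rho> a = 0") auto
  show "measure_pmf.expectation (embed_pmf ?tr)
      (\<lambda>x. wgt (outcome \<pi> \<Delta> q t \<lparr>past = fst p, past_wgt = snd p, pilots = zs, cur = x\<rparr>) *
        h (hist (outcome \<pi> \<Delta> q t \<lparr>past = fst p, past_wgt = snd p, pilots = zs, cur = x\<rparr>))) =
      snd p * (\<Sum>a\<in>UNIV. ?\<rho> a / ?\<sigma> * h (fst p @ [a]))"
  proof (cases "?S = 0")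
    \<comment> \<open>All trial probabilities are 0, so the weight is 0 through division by zero,
      and \<open>covers\<close> makes the right-hand side 0 as well.\<close>
    case True
    then have 0: "?tr a = 0" for a by (simp add: trial_prob_def)
    have "?\<rho> a / ?\<sigma> * h (fst p @ [a]) = 0" for a using covers[of a] 0[of a] by auto
    then have "(\<Sum>a\<in>UNIV. ?\<rho> a / ?\<sigma> * h (fst p @ [a])) = 0" by (intro sum.neutral ballI)
    then show ?thesis by (simp add: outcome_def 0)
  next
    case False
    have "snd p * (?\<rho> a / (?\<sigma> * ?tr a)) * h (fst p @ [a]) * ?tr a =
        snd p * (?\<rho> a / ?\<sigma> * h (fst p @ [a]))" for a
      by (subst covers[symmetric]) (simp only: mult_ac)
    then show ?thesis
      by (subst integral_measure_pmf_real[of UNIV])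
        (auto simp: outcome_def pmf_trial[OF False] sum_distrib_left)
  qed
qed (simp add: predictive_def)

lemma properly_weighted_aux_step:
  assumes t: "t \<ge> 1" and D: "properly_weighted D (\<pi> (t - 1))"
    and len: "\<And>p. p \<in> set_pmf D \<Longrightarrow> length (fst p) = t"
  shows "properly_weighted (map_pmf (aux_sample \<pi> \<Delta> q t) (D \<bind> step \<pi> \<Delta> q t)) (prefix_law \<pi> (t + \<Delta>) t)"
  unfolding aux_sample_def[abs_def]
  by (rule properly_weighted_step[OF D finite_target,
      where V = "\<lambda>d. \<Sum>a\<in>UNIV. U_of \<pi> \<Delta> q t d a" and G = "predictive \<Delta> t"])
    (simp_all only: expectation_step_aux[OF t len] expectation_predictive[OF t], simp_all add: outcome_def)

lemma prefix_law_self: "prefix_law \<pi> t t = \<pi> t"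
proof -
  have "map_pmf (take (t + 1)) (\<pi> t) = map_pmf id (\<pi> t)"
    by (intro map_pmf_cong refl) (auto dest: length_target)
  then show ?thesis by (simp add: prefix_law_def)
qed

lemma expectation_predictive_0:
  "t \<ge> 1 \<Longrightarrow> measure_pmf.expectation (\<pi> (t - 1)) (predictive 0 t h) = measure_pmf.expectation (\<pi> t) h"
  using expectation_predictive[of t 0 h] by (simp add: prefix_law_self)

lemma properly_weighted_wgt_step:
  assumes t: "t \<ge> 1" and D: "properly_weighted D (\<pi> (t - 1))"
    and len: "\<And>p. p \<in> set_pmf D \<Longrightarrow> length (fst p) = t"
  shows "properly_weighted (map_pmf (\<lambda>d. (hist (outcome \<pi> \<Delta> q t d), wgt (outcome \<pi> \<Delta> q t d)))
    (D \<bind> step \<pi> \<Delta> q t)) (\<pi> t)"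
  by (rule properly_weighted_step[OF D finite_target,
      where V = "\<lambda>d. pmf (\<pi> t) (past d @ [cur d]) /
          (pmf (\<pi> (t - 1)) (past d) * trial_prob \<pi> \<Delta> q t (past d) (pilots d) (cur d))"
        and G = "predictive 0 t"])
    (simp_all only: expectation_step_wgt[OF t len] expectation_predictive_0[OF t], simp_all add: outcome_def)

end

section \<open>Resampling\<close>

lemma pmf_priority:
  assumes "\<And>k. k < m \<Longrightarrow> \<alpha> k > 0" "m > 0"
  shows "pmf (priority_pmf m \<alpha>) k = (if k < m then \<alpha> k / (\<Sum>l<m. \<alpha> l) else 0)"
  unfolding priority_pmf_def
proof (rule pmf_embed_pmf)
  let ?f = "\<lambda>k. if k < m then \<alpha> k / (\<Sum>l<m. \<alpha> l) else 0"
  have pos: "(\<Sum>l<m. \<alpha> l) > 0" using assms by (intro sum_pos) auto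
  then show nn: "0 \<le> ?f k" for k
    using assms(1)[of k] by (cases "k < m") (simp_all add: divide_nonneg_pos less_imp_le)
  have "(\<integral>\<^sup>+ k. ennreal (?f k) \<partial>count_space UNIV) = (\<Sum>k<m. ennreal (?f k))"
    by (rule nn_integral_count_space') auto
  also have "\<dots> = ennreal (\<Sum>k<m. ?f k)"
    using nn by (intro sum_ennreal)
  also have "(\<Sum>k<m. ?f k) = 1"
    using pos by (simp flip: sum_divide_distrib)
  finally show "(\<integral>\<^sup>+ k. ennreal (?f k) \<partial>count_space UNIV) = 1" by simp
qed

lemma set_pmf_priority:
  assumes "\<And>k. k < m \<Longrightarrow> \<alpha> k > 0" "m > 0"
  shows "set_pmf (priority_pmf m \<alpha>) \<subseteq> {..<m}"
  using pmf_priority[OF assms] by (auto simp: set_pmf_iff split: if_splits)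

lemma set_pmf_resample:
  assumes \<alpha>: "\<And>k. k < m \<Longrightarrow> \<alpha> k > 0" and X: "X' \<in> set_pmf (resample m \<alpha> X)" and j: "j < m"
  obtains k where "k < m" "X' j = (fst (X k), snd (X k) / \<alpha> k)"
proof -
  have "X' j \<in> (\<lambda>k. (fst (X k), snd (X k) / \<alpha> k)) ` set_pmf (priority_pmf m \<alpha>)"
    using X j by (auto simp: resample_def set_Pi_pmf PiE_dflt_def)
  then show ?thesis using that set_pmf_priority[of m \<alpha>, OF \<alpha>] j by fastforce
qed

lemma finite_set_resample:
  assumes "\<And>k. k < m \<Longrightarrow> \<alpha> k > 0"
  shows "finite (set_pmf (resample m \<alpha> X))"
  unfolding resample_def
  using finite_subset[OF set_pmf_priority[of m \<alpha>, OF assms]]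
  by (intro finite_set_Pi_pmf) auto

text \<open>Given the old set, the resampled pairs are independent with mean the old average divided
  by the average score. This ratio is close to \<open>c\<close> if the two averages are close to
  \<open>c\<close> and 1 and the scores stay above \<open>b\<close>.\<close>

lemma resample_mean_square:
  assumes \<alpha>: "\<And>k. k < m \<Longrightarrow> b \<le> \<alpha> k" and b: "b > 0"
    and B: "\<And>k. k < m \<Longrightarrow> \<bar>snd (X k) / \<alpha> k * h (fst (X k))\<bar> \<le> B"
  shows "measure_pmf.expectation (resample m \<alpha> X) (\<lambda>X'. (average m (\<lambda>p. snd p * h (fst p)) X' - c)\<^sup>2)
    \<le> B\<^sup>2 / m + (1 + 2 * (1 + c\<^sup>2) / b\<^sup>2) *
      ((average m (\<lambda>p. snd p * h (fst p)) X - c)\<^sup>2 + (average m (\<lambda>a. a) \<alpha> - 1)\<^sup>2)"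
proof (cases "m = 0")
  case True
  \<comment> \<open>The empty average is 0, so the left side is \<open>c\<^sup>2\<close>; the
    summand 1 in the constant is what covers this case.\<close>
  have "c\<^sup>2 \<le> (1 + 2 * (1 + c\<^sup>2) / b\<^sup>2) * (c\<^sup>2 + 1)"
    using mult_mono[of 1 "1 + 2 * (1 + c\<^sup>2) / b\<^sup>2" "c\<^sup>2" "c\<^sup>2 + 1"] by simp
  then show ?thesis using True by (simp add: resample_def average_def)
next
  case False
  then have m: "m > 0" by simp
  have pos: "\<And>k. k < m \<Longrightarrow> \<alpha> k > 0" using \<alpha> b by fastforce
  let ?k = "map_pmf (\<lambda>k. (fst (X k), snd (X k) / \<alpha> k)) (priority_pmf m \<alpha>)"
  define A where "A = average m (\<lambda>p. snd p * h (fst p)) X"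
  define \<beta> where "\<beta> = average m (\<lambda>a. a) \<alpha>"
  note sub = set_pmf_priority[of m \<alpha>, OF pos m]
  \<comment> \<open>The score in the drawing probability cancels the division of the weight by that
    score.\<close>
  have "measure_pmf.expectation ?k (\<lambda>p. snd p * h (fst p)) =
      (\<Sum>k<m. snd (X k) / \<alpha> k * h (fst (X k)) * (\<alpha> k / (\<Sum>l<m. \<alpha> l)))"
    using sub by (subst integral_map_pmf, subst integral_measure_pmf_real[of "{..<m}"])
      (auto simp: pmf_priority[of m \<alpha>, OF pos m])
  also have "\<dots> = (\<Sum>k<m. snd (X k) * h (fst (X k)) / (\<Sum>l<m. \<alpha> l))"
    using pos by (intro sum.cong) (auto simp: less_imp_neq[symmetric])
  also have "\<dots> = A / \<beta>"
    using m by (simp add: A_def \<beta>_def average_def flip: sum_divide_distrib)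
  finally have mean: "(\<Sum>j<m. measure_pmf.expectation ?k (\<lambda>p. snd p * h (fst p))) / m = A / \<beta>"
    using m by simp
  have "(\<Sum>l<m. \<alpha> l) \<ge> m * b" using sum_bounded_below[of "{..<m}" b \<alpha>] \<alpha> by simp
  then have \<beta>: "\<beta> \<ge> b" using m by (simp add: \<beta>_def average_def field_simps)
  define d where "d = (A - c)\<^sup>2 + (\<beta> - 1)\<^sup>2"
  have d: "d \<ge> 0" by (simp add: d_def)
  \<comment> \<open>The error of the ratio is expressed by the errors of \<open>A\<close> and
    \<beta>; the constant comes from
    \<open>(u + v)\<^sup>2 \<le> 2 * u\<^sup>2 + 2 * v\<^sup>2\<close> and from \<beta> being at
    least \<open>b\<close>.\<close>
  have "A / \<beta> - c = (A - c * \<beta>) / \<beta>"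
    using \<beta> b by (simp add: diff_divide_distrib)
  also have "A - c * \<beta> = (A - c) + (- c) * (\<beta> - 1)" by (simp add: right_diff_distrib)
  finally have "(A / \<beta> - c)\<^sup>2 = ((A - c) + (- c) * (\<beta> - 1))\<^sup>2 / \<beta>\<^sup>2"
    by (simp only: power_divide)
  also have "\<dots> \<le> ((A - c) + (- c) * (\<beta> - 1))\<^sup>2 / b\<^sup>2"
    using \<beta> b by (intro divide_left_mono power_mono mult_pos_pos zero_less_power) auto
  also have "\<dots> \<le> 2 * (1 + c\<^sup>2) * d / b\<^sup>2"
  proof (rule divide_right_mono)
    have "(u + v)\<^sup>2 \<le> 2 * u\<^sup>2 + 2 * v\<^sup>2" for u v :: real
      using zero_le_power2[of "u - v"] by (simp add: power2_sum power2_diff)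
    then have "((A - c) + (- c) * (\<beta> - 1))\<^sup>2 \<le> 2 * (A - c)\<^sup>2 + 2 * ((- c) * (\<beta> - 1))\<^sup>2" .
    also have "\<dots> = 2 * (A - c)\<^sup>2 + 2 * (c\<^sup>2 * (\<beta> - 1)\<^sup>2)"
      by (simp only: power_mult_distrib power2_minus)
    also have "\<dots> \<le> 2 * d + 2 * (c\<^sup>2 * d)"
      unfolding d_def by (intro add_mono mult_left_mono) auto
    finally show "((A - c) + (- c) * (\<beta> - 1))\<^sup>2 \<le> 2 * (1 + c\<^sup>2) * d"
      by (simp only: distrib_left distrib_right mult.assoc mult_1_right mult_1_left)
  qed simp
  also have "\<dots> \<le> (1 + 2 * (1 + c\<^sup>2) / b\<^sup>2) * d"
    using d by (simp add: distrib_right)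
  finally have "(A / \<beta> - c)\<^sup>2 \<le> (1 + 2 * (1 + c\<^sup>2) / b\<^sup>2) * d" .
  moreover have "measure_pmf.expectation (resample m \<alpha> X)
      (\<lambda>X'. (average m (\<lambda>p. snd p * h (fst p)) X' - c)\<^sup>2) \<le> B\<^sup>2 / m + (A / \<beta> - c)\<^sup>2"
    unfolding resample_def mean[symmetric]
    using sub B by (intro average_Pi_pmf_mean_square) (auto dest: finite_subset)
  ultimately show ?thesis unfolding A_def[symmetric] \<beta>_def[symmetric] d_def[symmetric] by linarith
qed

section \<open>Exchangeability\<close>

lemma pmf_map_inverse:
  assumes "\<And>x. g (f x) = x" "\<And>x. f (g x) = x"
  shows "pmf (map_pmf f p) x = pmf p (g x)"
  using pmf_map_inj'[of f p "g x"] assms by (metis injI)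

lemma Pi_pmf_permute:
  assumes A: "finite A" and \<sigma>: "\<sigma> permutes A"
  shows "map_pmf (\<lambda>T. T \<circ> \<sigma>) (Pi_pmf A d p) = Pi_pmf A d (p \<circ> \<sigma>)"
proof (rule pmf_eqI)
  fix T
  have "pmf (map_pmf (\<lambda>T. T \<circ> \<sigma>) (Pi_pmf A d p)) T = pmf (Pi_pmf A d p) (T \<circ> inv \<sigma>)"
    by (rule pmf_map_inverse) (simp_all add: fun_eq_iff permutes_inverses[OF \<sigma>])
  also have "\<dots> = pmf (Pi_pmf A d (p \<circ> \<sigma>)) T"
  proof -
    have "(\<forall>x. x \<notin> A \<longrightarrow> (T \<circ> inv \<sigma>) x = d) \<longleftrightarrow> (\<forall>x. x \<notin> A \<longrightarrow> T x = d)"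
      using permutes_not_in[OF permutes_inv[OF \<sigma>]] by simp
    moreover have "(\<Prod>x\<in>A. pmf (p x) ((T \<circ> inv \<sigma>) x)) = (\<Prod>x\<in>A. pmf ((p \<circ> \<sigma>) x) (T x))"
      by (subst prod.permute[OF \<sigma>]) (simp add: o_def permutes_inverses[OF \<sigma>])
    ultimately show ?thesis using A by (simp only: pmf_Pi)
  qed
  finally show "pmf (map_pmf (\<lambda>T. T \<circ> \<sigma>) (Pi_pmf A d p)) T = pmf (Pi_pmf A d (p \<circ> \<sigma>)) T" .
qed

text \<open>Exchangeability passes through a stage whose kernel commutes with relabelling:
  relabelling the output amounts to relabelling the input, whose law is invariant.\<close>

lemma map_bind_pmf_invariant:
  assumes "map_pmf \<phi> P = P" "\<And>S. S \<in> set_pmf P \<Longrightarrow> map_pmf \<psi> (K S) = K (\<phi> S)"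
  shows "map_pmf \<psi> (P \<bind> K) = P \<bind> K"
proof -
  have "map_pmf \<psi> (P \<bind> K) = P \<bind> (\<lambda>S. K (\<phi> S))"
    unfolding map_bind_pmf by (rule bind_pmf_cong) (use assms in auto)
  also have "\<dots> = map_pmf \<phi> P \<bind> K" by (simp add: bind_map_pmf)
  finally show ?thesis using assms by simp
qed

text \<open>The total score is unchanged by relabelling, so an index drawn with permuted scores and
  translated back by \<sigma> has the original law.\<close>

lemma priority_permute:
  assumes \<alpha>: "\<And>k. k < m \<Longrightarrow> \<alpha> k > 0" and m: "m > 0" and \<sigma>: "\<sigma> permutes {..<m}"
  shows "map_pmf \<sigma> (priority_pmf m (\<alpha> \<circ> \<sigma>)) = priority_pmf m \<alpha>"
proof (rule pmf_eqI)
  fix k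
  have mem: "inv \<sigma> k < m \<longleftrightarrow> k < m" "\<And>k. \<sigma> k < m \<longleftrightarrow> k < m"
    using permutes_in_image[OF permutes_inv[OF \<sigma>]] permutes_in_image[OF \<sigma>] by auto
  have "pmf (map_pmf \<sigma> (priority_pmf m (\<alpha> \<circ> \<sigma>))) k = pmf (priority_pmf m (\<alpha> \<circ> \<sigma>)) (inv \<sigma> k)"
    by (rule pmf_map_inverse) (simp_all add: permutes_inverses[OF \<sigma>])
  also have "\<dots> = pmf (priority_pmf m \<alpha>) k"
    using \<alpha> m mem sum.permute[OF \<sigma>, of \<alpha>]
    by (subst (1 2) pmf_priority) (auto simp: permutes_inverses[OF \<sigma>] o_def)
  finally show "pmf (map_pmf \<sigma> (priority_pmf m (\<alpha> \<circ> \<sigma>))) k = pmf (priority_pmf m \<alpha>) k" .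
qed

text \<open>The resampled pairs are independent with one common law, which does not depend on the
  labels of the old pairs; so permuting the outputs and permuting the inputs both leave the law as
  it is.\<close>

lemma resample_permute:
  assumes \<alpha>: "\<And>k. k < m \<Longrightarrow> \<alpha> k > 0" and \<sigma>: "\<sigma> permutes {..<m}"
  shows "map_pmf (\<lambda>X'. X' \<circ> \<sigma>) (resample m \<alpha> X) = resample m (\<alpha> \<circ> \<sigma>) (X \<circ> \<sigma>)"
proof (cases "m = 0")
  case True
  then show ?thesis by (simp add: resample_def comp_def)
next
  case False
  have "map_pmf (\<lambda>k. (fst (X k), snd (X k) / \<alpha> k)) (priority_pmf m \<alpha>) =
      map_pmf (\<lambda>k. (fst ((X \<circ> \<sigma>) k), snd ((X \<circ> \<sigma>) k) / (\<alpha> \<circ> \<sigma>) k)) (priority_pmf m (\<alpha> \<circ> \<sigma>))"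
    using False by (subst priority_permute[symmetric, OF \<alpha> _ \<sigma>]) (simp_all add: pmf.map_comp comp_def)
  then show ?thesis
    unfolding resample_def by (simp add: Pi_pmf_permute[OF _ \<sigma>, unfolded comp_def] comp_def)
qed

lemma sample_set_permute:
  assumes "\<sigma> permutes {..<m}"
  shows "sample_set m (S \<circ> \<sigma>) = sample_set m S"
proof -
  have "image_mset \<sigma> (mset_set {..<m}) = mset_set {..<m}"
    using assms by (subst image_mset_mset_set) (auto simp: permutes_image intro: permutes_inj_on)
  then show ?thesis
    unfolding sample_set_def by (metis multiset.map_comp)
qed

section \<open>The whole algorithm\<close>

locale lookahead_run = lookahead_setting \<pi> \<Delta> q0 q
  for \<pi> :: "nat \<Rightarrow> 'a::finite list pmf" and \<Delta> q0 q +
  fixes dec :: "nat \<Rightarrow> 'a particle multiset \<Rightarrow> bool"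
  assumes scores_pos: "\<And>m s S j. s \<ge> 1 \<Longrightarrow> S \<in> set_pmf (lookahead \<pi> \<Delta> q0 q dec m (s - 1)) \<Longrightarrow>
          dec s (sample_set m S) \<Longrightarrow> j < m \<Longrightarrow> aux (S j) > 0"
begin

abbreviation run :: "nat \<Rightarrow> nat \<Rightarrow> (nat \<Rightarrow> 'a particle) pmf" where
  "run \<equiv> lookahead \<pi> \<Delta> q0 q dec"

text \<open>The index lags by one: this is the weighted set of time \<open>t\<close> after the
  optional resampling that opens time \<open>t + 1\<close>.\<close>

definition inputs :: "nat \<Rightarrow> nat \<Rightarrow> (nat \<Rightarrow> 'a list \<times> real) pmf" where
  "inputs m t = run m t \<bind> optional_resample dec m (Suc t)"

lemma scores_pos':
  "S \<in> set_pmf (run m t) \<Longrightarrow> dec (Suc t) (sample_set m S) \<Longrightarrow> j < m \<Longrightarrow> aux (S j) > 0"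
  using scores_pos[of "Suc t" S m j] by simp

lemma lookahead_draws_Suc:
  "lookahead_draws \<pi> \<Delta> q0 q dec m (Suc t) = inputs m t \<bind> steps \<pi> \<Delta> q m (Suc t)"
  by (simp add: lookahead_draws_def inputs_def draws_def[abs_def] bind_assoc_pmf)

lemma run_Suc:
  "run m (Suc t) = map_pmf (\<lambda>T j. if j < m then outcome \<pi> \<Delta> q (Suc t) (T j) else no_particle)
     (lookahead_draws \<pi> \<Delta> q0 q dec m (Suc t))"
  by (simp add: lookahead_draws_def map_bind_pmf map_pmf_def bind_assoc_pmf)

lemma optional_resample_cases:
  assumes "S \<in> set_pmf (run m t)" "X \<in> set_pmf (optional_resample dec m (Suc t) S)" "j < m"
  obtains k where "k < m" "X j = (hist (S k), wgt (S k)) \<or> X j = (hist (S k), wgt (S k) / aux (S k))"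
proof (cases "dec (Suc t) (sample_set m S)")
  case True
  then show ?thesis
    using assms that set_pmf_resample[of m "\<lambda>j. aux (S j)" X "\<lambda>j. (hist (S j), wgt (S j))" j]
      scores_pos'[OF assms(1)] by (auto simp: optional_resample_def)
next
  case False
  then show ?thesis using assms that by (auto simp: optional_resample_def)
qed

section \<open>Finiteness of supports, and of particle values uniformly in the sample size\<close>

lemma finite_set_optional_resample:
  assumes "S \<in> set_pmf (run m t)"
  shows "finite (set_pmf (optional_resample dec m (Suc t) S))"
  using scores_pos'[OF assms] by (simp add: optional_resample_def Let_def finite_set_resample)

lemma finite_set_steps: "finite (set_pmf (steps \<pi> \<Delta> q m t X))"
  unfolding steps_def by (intro finite_set_Pi_pmf finite_set_step) auto

lemma finite_set_init: "finite (set_pmf (init_particle \<pi> \<Delta> q0 q))"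
  by (auto simp: init_particle_def Let_def intro!: finite_set_pilot)

lemma finite_set_run: "finite (set_pmf (run m t))"
proof (induction t)
  case 0
  then show ?case using finite_set_init by (auto intro!: finite_set_Pi_pmf)
next
  case (Suc t)
  then show ?case
    by (auto simp: draws_def intro!: finite_set_optional_resample finite_set_steps)
qed

lemma finite_set_inputs: "finite (set_pmf (inputs m t))"
  by (auto simp: inputs_def intro!: finite_set_run finite_set_optional_resample)

lemma finite_set_draws: "finite (set_pmf (lookahead_draws \<pi> \<Delta> q0 q dec m (Suc t)))"
  by (auto simp: lookahead_draws_Suc intro!: finite_set_inputs finite_set_steps)

text \<open>The union runs over all \<open>m\<close>, so that its finiteness gives bounds
  independent of the sample size.\<close>

definition values_run :: "nat \<Rightarrow> 'a particle set" where
  "values_run t = (\<Union>m. \<Union>S\<in>set_pmf (run m t). S ` {..<m})"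

definition values_inputs :: "nat \<Rightarrow> ('a list \<times> real) set" where
  "values_inputs t = (\<Union>m. \<Union>X\<in>set_pmf (inputs m t). X ` {..<m})"

text \<open>Resampling copies a particle and divides its weight by its own score, not by a quantity
  depending on the rest of the sample, so the possible values do not multiply as \<open>m\<close>
  grows.\<close>

lemma values_inputs_subset:
  "values_inputs t \<subseteq> (\<lambda>p. (hist p, wgt p)) ` values_run t \<union> (\<lambda>p. (hist p, wgt p / aux p)) ` values_run t"
proof
  fix x assume "x \<in> values_inputs t"
  then obtain m S X j where S: "S \<in> set_pmf (run m t)"
      and X: "X \<in> set_pmf (optional_resample dec m (Suc t) S)" "j < m" and x: "x = X j"
    by (auto simp: values_inputs_def inputs_def)
  obtain k where k: "k < m"
      and Xj: "X j = (hist (S k), wgt (S k)) \<or> X j = (hist (S k), wgt (S k) / aux (S k))"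
    using optional_resample_cases[OF S X] .
  have "S k \<in> values_run t" using S k by (auto simp: values_run_def)
  then show "x \<in> (\<lambda>p. (hist p, wgt p)) ` values_run t \<union> (\<lambda>p. (hist p, wgt p / aux p)) ` values_run t"
    using Xj x by blast
qed

lemma steps_values:
  assumes "X \<in> set_pmf (inputs m t)" "T \<in> set_pmf (steps \<pi> \<Delta> q m (Suc t) X)" "j < m"
  shows "T j \<in> (\<Union>p\<in>values_inputs t. set_pmf (step \<pi> \<Delta> q (Suc t) p))"
proof -
  have "T j \<in> set_pmf (step \<pi> \<Delta> q (Suc t) (X j))"
    using assms by (auto simp: steps_def set_Pi_pmf PiE_dflt_def)
  moreover have "X j \<in> values_inputs t"
    using assms by (auto simp: values_inputs_def)
  ultimately show ?thesis by blast
qed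

lemma values_run_Suc_subset:
  "values_run (Suc t) \<subseteq> outcome \<pi> \<Delta> q (Suc t) ` (\<Union>p\<in>values_inputs t. set_pmf (step \<pi> \<Delta> q (Suc t) p))"
  unfolding values_run_def run_Suc lookahead_draws_Suc using steps_values by fastforce

lemma values_run_0_subset: "values_run 0 \<subseteq> set_pmf (init_particle \<pi> \<Delta> q0 q)"
  by (auto simp: values_run_def set_Pi_pmf PiE_dflt_def)

lemma finite_values_run: "finite (values_run t)"
proof (induction t)
  case 0
  show ?case using values_run_0_subset finite_set_init by (rule finite_subset)
next
  case (Suc t)
  then have "finite (values_inputs t)"
    by (intro finite_subset[OF values_inputs_subset]) auto
  then show ?case
    by (intro finite_subset[OF values_run_Suc_subset]) (auto intro: finite_set_step)
qed

lemma finite_values_inputs: "finite (values_inputs t)"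
  by (intro finite_subset[OF values_inputs_subset]) (simp add: finite_values_run)

lemma length_values_run: "p \<in> values_run t \<Longrightarrow> length (hist p) = Suc t"
proof (induction t arbitrary: p)
  case 0
  then have "p \<in> set_pmf (init_particle \<pi> \<Delta> q0 q)" using values_run_0_subset by blast
  then show ?case by (auto simp: init_particle_def Let_def)
next
  case (Suc t)
  have "length (fst x) = Suc t" if "x \<in> values_inputs t" for x
    using values_inputs_subset that Suc.IH by fastforce
  then show ?case
    using values_run_Suc_subset Suc.prems by (fastforce simp: outcome_def set_pmf_step)
qed

lemma length_values_inputs: "x \<in> values_inputs t \<Longrightarrow> length (fst x) = Suc t"
  using values_inputs_subset length_values_run by fastforce

lemma inputs_values: "X \<in> set_pmf (inputs m t) \<Longrightarrow> j < m \<Longrightarrow> X j \<in> values_inputs t"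
  by (auto simp: values_inputs_def)

lemma run_values: "S \<in> set_pmf (run m t) \<Longrightarrow> j < m \<Longrightarrow> S j \<in> values_run t"
  by (auto simp: values_run_def)

section \<open>Mean square limits through resampling and drawing\<close>

lemma mean_square_limit_inputs:
  assumes w: "mean_square_limit (\<lambda>m. run m t) (\<lambda>m. average m (\<lambda>s. wgt s * h (hist s))) c"
    and a: "mean_square_limit (\<lambda>m. run m t) (\<lambda>m. average m aux) 1"
  shows "mean_square_limit (\<lambda>m. inputs m t) (\<lambda>m. average m (\<lambda>p. snd p * h (fst p))) c"
proof -
  obtain B where B: "\<And>s. s \<in> values_run t \<Longrightarrow> \<bar>wgt s / aux s * h (hist s)\<bar> \<le> B"
    using finite_abs_bound[OF finite_values_run, where f = "\<lambda>s. wgt s / aux s * h (hist s)"] by blast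
  \<comment> \<open>The least positive score that can occur at time \<open>t\<close>, capped by 1 so
    that the minimum is over a nonempty set.\<close>
  define b where "b = Min (insert 1 (aux ` {s \<in> values_run t. aux s > 0}))"
  have fin: "finite (insert 1 (aux ` {s \<in> values_run t. aux s > 0}))" using finite_values_run by simp
  have b: "b > 0" unfolding b_def using fin by (subst Min_gr_iff) auto
  have b_le: "b \<le> aux s" if "s \<in> values_run t" "aux s > 0" for s
    unfolding b_def using fin that by (intro Min_le) auto
  define C where "C = 1 + 2 * (1 + c\<^sup>2) / b\<^sup>2"
  have C: "C \<ge> 1" by (simp add: C_def)
  define R :: "nat \<Rightarrow> (nat \<Rightarrow> 'a particle) \<Rightarrow> real"
    where "R = (\<lambda>m S. (average m (\<lambda>s. wgt s * h (hist s)) S - c)\<^sup>2 + (average m aux S - 1)\<^sup>2)"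
  \<comment> \<open>Both branches of the decision get the same remainder \<open>C * R m S\<close>,
    so it does not matter how the decision depends on the sample.\<close>
  show ?thesis
    unfolding inputs_def
  proof (rule mean_square_limit_bind[where B = "B\<^sup>2" and R = "\<lambda>m S. C * R m S"])
    have "(\<lambda>m. C * (measure_pmf.expectation (run m t) (\<lambda>S. (average m (\<lambda>s. wgt s * h (hist s)) S - c)\<^sup>2) +
        measure_pmf.expectation (run m t) (\<lambda>S. (average m aux S - 1)\<^sup>2))) \<longlonglongrightarrow> C * (0 + 0)"
      using w a unfolding mean_square_limit_def by (intro tendsto_intros)
    then show "(\<lambda>m. measure_pmf.expectation (run m t) (\<lambda>S. C * R m S)) \<longlonglongrightarrow> 0"
      by (simp add: R_def Bochner_Integration.integral_add integrable_measure_pmf_finite finite_set_run)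
    fix m S assume S: "S \<in> set_pmf (run m t)"
    note SV = run_values[OF S]
    show "measure_pmf.expectation (optional_resample dec m (Suc t) S)
        (\<lambda>X. (average m (\<lambda>p. snd p * h (fst p)) X - c)\<^sup>2) \<le> B\<^sup>2 / real m + C * R m S"
    proof (cases "dec (Suc t) (sample_set m S)")
      case True
      have "b \<le> aux (S k)" if "k < m" for k
        using b_le SV scores_pos'[OF S True] that by blast
      then show ?thesis
        using True b B SV
          resample_mean_square[of m b "\<lambda>k. aux (S k)" "\<lambda>k. (hist (S k), wgt (S k))" h B c]
        by (simp add: optional_resample_def R_def C_def average_def)
    next
      case False
      \<comment> \<open>Without resampling the average is unchanged, and \<open>C \<ge> 1\<close>
        lets the common bound cover it.\<close>
      have "(average m (\<lambda>s. wgt s * h (hist s)) S - c)\<^sup>2 \<le> R m S" by (simp add: R_def)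
      also have "\<dots> \<le> C * R m S" using C mult_right_mono[of 1 C "R m S"] by (simp add: R_def)
      also have "\<dots> \<le> B\<^sup>2 / real m + C * R m S" by simp
      finally show ?thesis
        using False by (simp add: optional_resample_def average_def)
    qed
  qed (auto intro: finite_set_run finite_set_optional_resample)
qed

lemma mean_square_limit_draws:
  assumes lim: "mean_square_limit (\<lambda>m. inputs m t) (\<lambda>m. average m (\<lambda>p. snd p * g (fst p))) c"
    and g: "\<And>p. length (fst p) = Suc t \<Longrightarrow>
      measure_pmf.expectation (step \<pi> \<Delta> q (Suc t) p) f = snd p * g (fst p)"
  shows "mean_square_limit (\<lambda>m. lookahead_draws \<pi> \<Delta> q0 q dec m (Suc t)) (\<lambda>m. average m f) c"
proof -
  let ?V = "\<Union>p\<in>values_inputs t. set_pmf (step \<pi> \<Delta> q (Suc t) p)"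
  have "finite ?V" using finite_values_inputs finite_set_step by blast
  then obtain B where B: "\<And>d. d \<in> ?V \<Longrightarrow> \<bar>f d\<bar> \<le> B"
    using finite_abs_bound[where f = f] by blast
  show ?thesis
    unfolding lookahead_draws_Suc steps_def
  proof (rule mean_square_limit_kernel[OF finite_set_inputs lim])
    fix m X j assume X: "X \<in> set_pmf (inputs m t)" "j < m"
    show "measure_pmf.expectation (step \<pi> \<Delta> q (Suc t) (X j)) f = snd (X j) * g (fst (X j))"
      using inputs_values[OF X] by (intro g length_values_inputs)
    show "\<bar>f v\<bar> \<le> B" if "v \<in> set_pmf (step \<pi> \<Delta> q (Suc t) (X j))" for v
      using inputs_values[OF X] that by (intro B) blast
  qed (rule finite_set_step)
qed

section \<open>The initial importance sample\<close>

lemma expectation_init_wgt: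
  "measure_pmf.expectation (init_particle \<pi> \<Delta> q0 q) (\<lambda>s. wgt s * h (hist s)) =
   measure_pmf.expectation (\<pi> 0) h"
proof -
  have "measure_pmf.expectation (init_particle \<pi> \<Delta> q0 q) (\<lambda>s. wgt s * h (hist s)) =
      measure_pmf.expectation q0 (\<lambda>x. pmf (\<pi> 0) [x] / pmf q0 x * h [x])"
    by (simp add: init_particle_def Let_def expectation_bind_pmf_finite finite_set_pilot)
  also have "\<dots> = (\<Sum>x\<in>UNIV. pmf (\<pi> 0) [x] / pmf q0 x * h [x] * pmf q0 x)"
    by (subst integral_measure_pmf_real[of UNIV]) auto
  also have "\<dots> = (\<Sum>x\<in>UNIV. pmf (\<pi> 0) [x] * h [x])"
  proof (intro sum.cong refl)
    fix x
    show "pmf (\<pi> 0) [x] / pmf q0 x * h [x] * pmf q0 x = pmf (\<pi> 0) [x] * h [x]"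
      using q0_covers[of x] pmf_pos[of "\<pi> 0" "[x]"] by (cases "pmf (\<pi> 0) [x] = 0") auto
  qed
  also have "\<dots> = measure_pmf.expectation (\<pi> 0) h"
    unfolding target_expectation sum_paths_Suc_0 ..
  finally show ?thesis .
qed

text \<open>Along a path possible under \<open>\<pi> \<Delta>\<close>, coverage and nesting make
  every denominator positive; all of them cancel and the total mass of \<open>\<pi> \<Delta>\<close>
  remains.\<close>

lemma expectation_init_aux: "measure_pmf.expectation (init_particle \<pi> \<Delta> q0 q) aux = 1"
proof -
  have "measure_pmf.expectation (init_particle \<pi> \<Delta> q0 q) aux =
      measure_pmf.expectation q0 (\<lambda>x. measure_pmf.expectation (pilot q \<Delta> [x]) (\<lambda>z.
        pmf (\<pi> 0) [x] / pmf q0 x * (pmf (\<pi> \<Delta>) (x # z) / (pmf (\<pi> 0) [x] * pilot_density q [x] z))))"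
    by (simp add: init_particle_def Let_def expectation_bind_pmf_finite finite_set_pilot)
  also have "\<dots> = (\<Sum>x\<in>UNIV. \<Sum>z\<in>paths \<Delta>. pmf (\<pi> 0) [x] / pmf q0 x *
      (pmf (\<pi> \<Delta>) (x # z) / (pmf (\<pi> 0) [x] * pilot_density q [x] z)) * pilot_density q [x] z * pmf q0 x)"
    by (subst integral_measure_pmf_real[of UNIV], simp, simp, intro sum.cong refl,
        subst integral_measure_pmf_real[OF finite_paths[of \<Delta>]])
      (auto simp: pmf_pilot sum_distrib_right dest: set_pmf_pilot)
  also have "\<dots> = (\<Sum>x\<in>UNIV. \<Sum>z\<in>paths \<Delta>. pmf (\<pi> \<Delta>) ([x] @ z))"
  proof (intro sum.cong refl)
    fix x and z :: "'a list" assume z: "z \<in> paths \<Delta>"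
    show "pmf (\<pi> 0) [x] / pmf q0 x * (pmf (\<pi> \<Delta>) (x # z) / (pmf (\<pi> 0) [x] * pilot_density q [x] z)) *
        pilot_density q [x] z * pmf q0 x = pmf (\<pi> \<Delta>) ([x] @ z)"
      using q0_covers[of x] pilot_covers[of "[x]" 0 z] target_prefix[of "[x]" 0 \<Delta> z] z
        pmf_pos[of "\<pi> \<Delta>" "x # z"]
      by (cases "pmf (\<pi> \<Delta>) (x # z) = 0") auto
  qed
  also have "\<dots> = (\<Sum>xs\<in>paths (Suc 0 + \<Delta>). pmf (\<pi> \<Delta>) xs)"
    by (simp only: sum_paths_append sum_paths_Suc_0)
  also have "\<dots> = measure_pmf.expectation (\<pi> \<Delta>) (\<lambda>_. 1)"
    by (simp only: target_expectation) simp
  finally show ?thesis by simp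
qed

lemma mean_square_limit_init:
  assumes "measure_pmf.expectation (init_particle \<pi> \<Delta> q0 q) f = c"
  shows "mean_square_limit (\<lambda>m. run m 0) (\<lambda>m. average m f) c"
proof -
  obtain B where B: "\<And>s. s \<in> set_pmf (init_particle \<pi> \<Delta> q0 q) \<Longrightarrow> \<bar>f s\<bar> \<le> B"
    using finite_abs_bound[OF finite_set_init, where f = f] by blast
  \<comment> \<open>The initial sample is treated as one stage after a one-point law. The average of
    the constant equals \<open>c\<close> only from \<open>m = 1\<close> on, as the empty average is
    0.\<close>
  have "mean_square_limit (\<lambda>m. return_pmf (\<lambda>_. ())) (\<lambda>m. average m (\<lambda>_. c)) c"
    unfolding mean_square_limit_def
    by (rule tendsto_eventually, rule eventually_sequentiallyI[of 1]) (simp add: average_def)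
  from mean_square_limit_kernel[OF _ this, where k = "\<lambda>_. init_particle \<pi> \<Delta> q0 q" and f = f and B = B
      and d = no_particle]
  show ?thesis using assms B finite_set_init by (simp add: bind_return_pmf)
qed

text \<open>The two limits need each other: resampling divides by the average score, and the limit
  of the new average score comes from the weighted average of a predictive test function. Hence a
  joint induction with arbitrary \<open>h\<close>.\<close>

lemma mean_square_limit_run:
  "mean_square_limit (\<lambda>m. run m t) (\<lambda>m. average m (\<lambda>s. wgt s * h (hist s))) (measure_pmf.expectation (\<pi> t) h)"
  and mean_square_limit_run_aux: "mean_square_limit (\<lambda>m. run m t) (\<lambda>m. average m aux) 1"
proof (induction t arbitrary: h)
  case 0
  show "mean_square_limit (\<lambda>m. run m 0) (\<lambda>m. average m (\<lambda>s. wgt s * h (hist s))) (measure_pmf.expectation (\<pi> 0) h)" for h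
    by (intro mean_square_limit_init expectation_init_wgt)
  show "mean_square_limit (\<lambda>m. run m 0) (\<lambda>m. average m aux) 1"
    by (intro mean_square_limit_init expectation_init_aux)
next
  case (Suc t)
  have avg: "average m f (\<lambda>j. if j < m then outcome \<pi> \<Delta> q (Suc t) (T j) else no_particle) =
      average m (\<lambda>d. f (outcome \<pi> \<Delta> q (Suc t) d)) T" for m T and f :: "'a particle \<Rightarrow> real"
    by (rule average_cong) simp
  show "mean_square_limit (\<lambda>m. run m (Suc t)) (\<lambda>m. average m (\<lambda>s. wgt s * h (hist s)))
      (measure_pmf.expectation (\<pi> (Suc t)) h)" for h
    unfolding run_Suc mean_square_limit_map avg
    using mean_square_limit_draws[OF mean_square_limit_inputs[OF Suc(1) Suc(2)] expectation_step_wgt]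
      expectation_predictive_0[of "Suc t"] by simp
  have "measure_pmf.expectation (\<pi> t) (predictive \<Delta> (Suc t) (\<lambda>_. 1)) = 1"
    using expectation_predictive[of "Suc t" \<Delta> "\<lambda>_. 1"] by simp
  then show "mean_square_limit (\<lambda>m. run m (Suc t)) (\<lambda>m. average m aux) 1"
    unfolding run_Suc mean_square_limit_map avg
    using mean_square_limit_draws[OF mean_square_limit_inputs[OF Suc(1) Suc(2)]
        expectation_step_aux[where h = "\<lambda>_. 1"]] by simp
qed

lemma mean_square_limit_lookahead_draws:
  assumes "\<And>p. length (fst p) = Suc t \<Longrightarrow>
      measure_pmf.expectation (step \<pi> \<Delta> q (Suc t) p) f = snd p * predictive n (Suc t) h (fst p)"
  shows "mean_square_limit (\<lambda>m. lookahead_draws \<pi> \<Delta> q0 q dec m (Suc t)) (\<lambda>m. average m f)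
    (measure_pmf.expectation (prefix_law \<pi> (Suc t + n) (Suc t)) h)"
  using mean_square_limit_draws[OF mean_square_limit_inputs[OF mean_square_limit_run mean_square_limit_run_aux]
      assms] expectation_predictive[of "Suc t" n h] by simp

lemma consistent_estimator_lookahead:
  "consistent_estimator (\<lambda>m. lookahead_draws \<pi> \<Delta> q0 q dec m (Suc t)) (estimator \<pi> \<Delta> q (Suc t) h)
     (measure_pmf.expectation (prefix_law \<pi> (Suc t + \<Delta>) (Suc t)) h)"
proof -
  let ?\<rho> = "prefix_law \<pi> (Suc t + \<Delta>) (Suc t)"
  let ?N = "\<lambda>h d. past_wgt d * (\<Sum>a\<in>UNIV. U_of \<pi> \<Delta> q (Suc t) d a * h (past d @ [a]))"
  let ?D = "\<lambda>d. aux (outcome \<pi> \<Delta> q (Suc t) d)"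
  define \<theta> where "\<theta> = measure_pmf.expectation ?\<rho> h"
  have "finite (set_pmf ?\<rho>)" using finite_target by (simp add: prefix_law_def)
  then have centred: "measure_pmf.expectation ?\<rho> (\<lambda>xs. h xs - \<theta>) = 0"
    by (simp add: \<theta>_def Bochner_Integration.integral_diff integrable_measure_pmf_finite)
  \<comment> \<open>By linearity the error term is itself a numerator, for the centred function
    \<open>h - \<theta>\<close>, so its limit is 0.\<close>
  have N: "average m (?N h) T - \<theta> * average m ?D T = average m (?N (\<lambda>xs. h xs - \<theta>)) T" for m T
  proof -
    have "(\<Sum>a\<in>UNIV. U_of \<pi> \<Delta> q (Suc t) d a * (h (past d @ [a]) - \<theta>)) =
        (\<Sum>a\<in>UNIV. U_of \<pi> \<Delta> q (Suc t) d a * h (past d @ [a])) - (\<Sum>a\<in>UNIV. U_of \<pi> \<Delta> q (Suc t) d a) * \<theta>"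
      for d by (simp add: right_diff_distrib sum_subtractf sum_distrib_right)
    then have "?N (\<lambda>xs. h xs - \<theta>) d = ?N h d - \<theta> * ?D d" for d
      by (simp add: outcome_def right_diff_distrib mult_ac)
    then show ?thesis
      by (simp add: average_def sum_subtractf diff_divide_distrib sum_distrib_left)
  qed
  have "consistent_estimator (\<lambda>m. lookahead_draws \<pi> \<Delta> q0 q dec m (Suc t))
      (\<lambda>m T. average m (?N h) T / average m ?D T) \<theta>"
  proof (rule consistent_ratio[OF finite_set_draws])
    show "mean_square_limit (\<lambda>m. lookahead_draws \<pi> \<Delta> q0 q dec m (Suc t))
        (\<lambda>m T. average m (?N h) T - \<theta> * average m ?D T) 0"
      unfolding N
      using mean_square_limit_lookahead_draws[OF expectation_step_estimator[where t = "Suc t" and h = "\<lambda>xs. h xs - \<theta>"]]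
      unfolding centred by simp
    show "mean_square_limit (\<lambda>m. lookahead_draws \<pi> \<Delta> q0 q dec m (Suc t)) (\<lambda>m. average m ?D) 1"
      using mean_square_limit_lookahead_draws[OF expectation_step_aux[where h = "\<lambda>_. 1"]] by simp
  qed
  \<comment> \<open>The factors \<open>1 / m\<close> cancel; at \<open>m = 0\<close> both sides are
    0.\<close>
  moreover have "estimator \<pi> \<Delta> q (Suc t) h = (\<lambda>m T. average m (?N h) T / average m ?D T)"
    by (auto simp: fun_eq_iff estimator_def average_def)
  ultimately show ?thesis by (simp add: \<theta>_def)
qed

section \<open>Exchangeability of the draws and asymptotic unbiasedness\<close>

lemma optional_resample_permute:
  assumes S: "S \<in> set_pmf (run m t)" and \<sigma>: "\<sigma> permutes {..<m}"
  shows "map_pmf (\<lambda>X. X \<circ> \<sigma>) (optional_resample dec m (Suc t) S) =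
    optional_resample dec m (Suc t) (S \<circ> \<sigma>)"
\<comment> \<open>The decision sees only the multiset of particles, which relabelling preserves, so
  both sides take the same branch.\<close>
proof (cases "dec (Suc t) (sample_set m S)")
  case True
  then show ?thesis
    using resample_permute[of m "\<lambda>j. aux (S j)", OF scores_pos'[OF S True] \<sigma>]
    by (simp add: optional_resample_def sample_set_permute[OF \<sigma>, unfolded comp_def] comp_def)
next
  case False
  then show ?thesis
    by (simp add: optional_resample_def sample_set_permute[OF \<sigma>, unfolded comp_def] comp_def)
qed

lemma draws_permute:
  assumes \<sigma>: "\<sigma> permutes {..<m}"
  shows "map_pmf (\<lambda>T. T \<circ> \<sigma>) (lookahead_draws \<pi> \<Delta> q0 q dec m (Suc t)) =
    lookahead_draws \<pi> \<Delta> q0 q dec m (Suc t)"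
proof -
  \<comment> \<open>Kept as an implication because it serves both inside the induction for
    \<open>run\<close> and for the final conclusion.\<close>
  have draws: "map_pmf (\<lambda>T. T \<circ> \<sigma>) (lookahead_draws \<pi> \<Delta> q0 q dec m (Suc t)) =
      lookahead_draws \<pi> \<Delta> q0 q dec m (Suc t)"
    if "map_pmf (\<lambda>S. S \<circ> \<sigma>) (run m t) = run m t" for t
  proof -
    have "map_pmf (\<lambda>X. X \<circ> \<sigma>) (inputs m t) = inputs m t"
      unfolding inputs_def
      by (rule map_bind_pmf_invariant[where \<phi> = "\<lambda>S. S \<circ> \<sigma>"])
        (rule that, erule optional_resample_permute[OF _ \<sigma>])
    moreover have "map_pmf (\<lambda>T. T \<circ> \<sigma>) (steps \<pi> \<Delta> q m (Suc t) X) = steps \<pi> \<Delta> q m (Suc t) (X \<circ> \<sigma>)" for X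
      by (simp add: steps_def Pi_pmf_permute[OF _ \<sigma>, unfolded o_def] o_def)
    ultimately show ?thesis
      unfolding lookahead_draws_Suc by (rule map_bind_pmf_invariant[where \<phi> = "\<lambda>X. X \<circ> \<sigma>"])
  qed
  have run: "map_pmf (\<lambda>S. S \<circ> \<sigma>) (run m t) = run m t" for t
  proof (induction t)
    case 0
    then show ?case by (simp add: Pi_pmf_permute[OF _ \<sigma>, unfolded comp_def] comp_def)
  next
    case (Suc t)
    \<comment> \<open>\<sigma> preserves the labels below \<open>m\<close>, so filling the other
      places with \<open>no_particle\<close> commutes with relabelling.\<close>
    have "(\<sigma> j < m) = (j < m)" for j using permutes_in_image[OF \<sigma>] by auto
    then have "map_pmf (\<lambda>S. S \<circ> \<sigma>) (run m (Suc t)) =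
        map_pmf (\<lambda>T j. if j < m then outcome \<pi> \<Delta> q (Suc t) (T j) else no_particle)
          (map_pmf (\<lambda>T. T \<circ> \<sigma>) (lookahead_draws \<pi> \<Delta> q0 q dec m (Suc t)))"
      unfolding run_Suc by (simp add: pmf.map_comp comp_def)
    then show ?case unfolding draws[OF Suc] run_Suc .
  qed
  show "map_pmf (\<lambda>T. T \<circ> \<sigma>) (lookahead_draws \<pi> \<Delta> q0 q dec m (Suc t)) = lookahead_draws \<pi> \<Delta> q0 q dec m (Suc t)"
    by (rule draws[OF run])
qed

text \<open>Swapping two labels preserves the law, so all particles have the same mean, which is
  then the mean of their average.\<close>

lemma expectation_draws_component:
  fixes f :: "'a draw \<Rightarrow> real"
  assumes j: "j < m"
  shows "measure_pmf.expectation (lookahead_draws \<pi> \<Delta> q0 q dec m (Suc t)) (\<lambda>T. f (T j)) =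
    measure_pmf.expectation (lookahead_draws \<pi> \<Delta> q0 q dec m (Suc t)) (average m f)"
proof -
  let ?P = "lookahead_draws \<pi> \<Delta> q0 q dec m (Suc t)"
  have swap: "measure_pmf.expectation ?P (\<lambda>T. f (T i)) = measure_pmf.expectation ?P (\<lambda>T. f (T j))"
    if "i < m" for i
  proof -
    have "measure_pmf.expectation ?P (\<lambda>T. f (T i)) =
        measure_pmf.expectation (map_pmf (\<lambda>T. T \<circ> Transposition.transpose i j) ?P) (\<lambda>T. f (T i))"
      using that j by (simp only: draws_permute permutes_swap_id lessThan_iff)
    then show ?thesis by simp
  qed
  have "measure_pmf.expectation ?P (average m f) = (\<Sum>i<m. measure_pmf.expectation ?P (\<lambda>T. f (T i))) / m"
    unfolding average_def
    by (simp add: Bochner_Integration.integral_sum integrable_measure_pmf_finite finite_set_draws)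
  also have "(\<Sum>i<m. measure_pmf.expectation ?P (\<lambda>T. f (T i))) =
      (\<Sum>i<m. measure_pmf.expectation ?P (\<lambda>T. f (T j)))"
    by (rule sum.cong[OF refl], rule swap) simp
  finally show ?thesis using j by simp
qed

lemma asymptotically_unbiased:
  "(\<lambda>m. measure_pmf.expectation (lookahead_draws \<pi> \<Delta> q0 q dec m (Suc t))
      (\<lambda>T. aux (outcome \<pi> \<Delta> q (Suc t) (T j)) * h (hist (outcome \<pi> \<Delta> q (Suc t) (T j)))))
    \<longlonglongrightarrow> measure_pmf.expectation (prefix_law \<pi> (Suc t + \<Delta>) (Suc t)) h"
proof -
  let ?f = "\<lambda>d. aux (outcome \<pi> \<Delta> q (Suc t) d) * h (hist (outcome \<pi> \<Delta> q (Suc t) d))"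
  have "(\<lambda>m. measure_pmf.expectation (lookahead_draws \<pi> \<Delta> q0 q dec m (Suc t)) (average m ?f))
      \<longlonglongrightarrow> measure_pmf.expectation (prefix_law \<pi> (Suc t + \<Delta>) (Suc t)) h"
    by (rule mean_square_limit_expectation[OF finite_set_draws
          mean_square_limit_lookahead_draws[OF expectation_step_aux]]) simp_all
  then show ?thesis
  proof (rule Lim_transform_eventually)
    show "\<forall>\<^sub>F m in sequentially. measure_pmf.expectation (lookahead_draws \<pi> \<Delta> q0 q dec m (Suc t)) (average m ?f) =
        measure_pmf.expectation (lookahead_draws \<pi> \<Delta> q0 q dec m (Suc t)) (\<lambda>T. ?f (T j))"
      \<comment> \<open>Label \<open>j\<close> belongs to the sample only if
        \<open>m > j\<close>.\<close>
      by (rule eventually_sequentiallyI[of "Suc j"])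
        (rule expectation_draws_component[where f = ?f, symmetric], simp)
  qed
qed

section \<open>Exact proper weighting of single particles\<close>

lemma steps_component:
  assumes "j < m"
  shows "map_pmf (\<lambda>T. T j) (D \<bind> steps \<pi> \<Delta> q m t) = map_pmf (\<lambda>X. X j) D \<bind> step \<pi> \<Delta> q t"
  using assms by (simp add: map_bind_pmf bind_map_pmf steps_def Pi_pmf_component)

lemma properly_weighted_aux_steps:
  assumes t: "t \<ge> 1" and j: "j < m" and D: "properly_weighted (map_pmf (\<lambda>X. X j) D) (\<pi> (t - 1))"
    and len: "\<And>X. X \<in> set_pmf D \<Longrightarrow> length (fst (X j)) = t"
  shows "properly_weighted (map_pmf (\<lambda>T. aux_sample \<pi> \<Delta> q t (T j)) (D \<bind> steps \<pi> \<Delta> q m t))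
    (prefix_law \<pi> (t + \<Delta>) t)"
proof -
  have "map_pmf (\<lambda>T. aux_sample \<pi> \<Delta> q t (T j)) (D \<bind> steps \<pi> \<Delta> q m t) =
      map_pmf (aux_sample \<pi> \<Delta> q t) (map_pmf (\<lambda>X. X j) D \<bind> step \<pi> \<Delta> q t)"
    unfolding steps_component[OF j, symmetric] by (simp add: pmf.map_comp comp_def)
  moreover have "length (fst p) = t" if "p \<in> set_pmf (map_pmf (\<lambda>X. X j) D)" for p
    using that len by auto
  ultimately show ?thesis using properly_weighted_aux_step[OF t D] by simp
qed

lemma inputs_no_resampling:
  assumes "\<And>X. \<not> dec (Suc t) X"
  shows "inputs m t = map_pmf (\<lambda>S j. (hist (S j), wgt (S j))) (run m t)"
  unfolding inputs_def map_pmf_def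
  by (intro bind_pmf_cong) (auto simp: optional_resample_def assms)

text \<open>Without resampling a particle is moved only by its own steps, so proper weighting
  propagates exactly from the importance sample at time 0.\<close>

lemma properly_weighted_run:
  assumes j: "j < m" and "\<And>s X. s \<in> {1..t} \<Longrightarrow> \<not> dec s X"
  shows "properly_weighted (map_pmf (\<lambda>S. (hist (S j), wgt (S j))) (run m t)) (\<pi> t)"
  using assms(2)
proof (induction t)
  case 0
  have "map_pmf (\<lambda>S. (hist (S j), wgt (S j))) (run m 0) =
      map_pmf (\<lambda>s. (hist s, wgt s)) (map_pmf (\<lambda>S. S j) (run m 0))"
    by (simp add: pmf.map_comp comp_def)
  also have "\<dots> = map_pmf (\<lambda>s. (hist s, wgt s)) (init_particle \<pi> \<Delta> q0 q)"
    using j by (simp add: Pi_pmf_component)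
  finally show ?case
    by (simp add: properly_weighted_def expectation_init_wgt integrable_measure_pmf_finite finite_set_init)
next
  case (Suc t)
  let ?D = "map_pmf (\<lambda>X. X j) (inputs m t)"
  have "?D = map_pmf (\<lambda>S. (hist (S j), wgt (S j))) (run m t)"
    using Suc.prems by (subst inputs_no_resampling) (auto simp: pmf.map_comp comp_def)
  then have D: "properly_weighted ?D (\<pi> (Suc t - 1))" using Suc by auto
  have len: "length (fst p) = Suc t" if "p \<in> set_pmf ?D" for p
    using that length_values_inputs[OF inputs_values[OF _ j]] by auto
  have eq: "map_pmf (\<lambda>S. (hist (S j), wgt (S j))) (run m (Suc t)) =
      map_pmf (\<lambda>d. (hist (outcome \<pi> \<Delta> q (Suc t) d), wgt (outcome \<pi> \<Delta> q (Suc t) d)))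
        (map_pmf (\<lambda>T. T j) (inputs m t \<bind> steps \<pi> \<Delta> q m (Suc t)))"
    unfolding run_Suc lookahead_draws_Suc using j by (simp add: pmf.map_comp comp_def)
  show ?case
    unfolding eq steps_component[OF j] by (rule properly_weighted_wgt_step[OF _ D len]) simp_all
qed

lemma properly_weighted_lookahead_draws:
  assumes j: "j < m" and nd: "\<And>s X. s \<in> {1..Suc t} \<Longrightarrow> \<not> dec s X"
  shows "properly_weighted (map_pmf (\<lambda>T. aux_sample \<pi> \<Delta> q (Suc t) (T j))
    (lookahead_draws \<pi> \<Delta> q0 q dec m (Suc t))) (prefix_law \<pi> (Suc t + \<Delta>) (Suc t))"
  unfolding lookahead_draws_Suc
proof (rule properly_weighted_aux_steps[OF _ j])
  show "properly_weighted (map_pmf (\<lambda>X. X j) (inputs m t)) (\<pi> (Suc t - 1))"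
    using properly_weighted_run[OF j, of t] nd
    by (subst inputs_no_resampling) (auto simp: pmf.map_comp comp_def)
qed (simp_all add: length_values_inputs[OF inputs_values[OF _ j]])

end

section \<open>Posteriors of a state space model\<close>

lemma obs_nonneg:
  assumes "is_ssm M" "\<And>s. s \<ge> 1 \<Longrightarrow> y s \<in> space (base M)" "s \<ge> 1" "length xs = Suc s"
  shows "0 \<le> obs M xs (obs_upto y (s - 1)) v"
proof -
  have "length xs = length (obs_upto y (s - 1)) + 2" "set (obs_upto y (s - 1)) \<subseteq> space (base M)"
    using assms(2-4) by (auto simp: obs_upto_def)
  then show ?thesis using assms(1) unfolding is_ssm_def by blast
qed

lemma joint_nonneg:
  assumes "is_ssm M" "\<And>s. s \<ge> 1 \<Longrightarrow> y s \<in> space (base M)" "length xs = Suc t"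
  shows "0 \<le> joint M y t xs"
  unfolding joint_def
  using assms by (intro mult_nonneg_nonneg prod_nonneg ballI obs_nonneg) auto

text \<open>The joint density of a prefix is a factor of that of any extension. This is the nesting
  of the posterior supports.\<close>

lemma joint_append_eq_0:
  assumes xs: "length xs = Suc s" and 0: "joint M y s xs = 0"
  shows "joint M y (s + n) (xs @ z) = 0"
proof -
  let ?f = "\<lambda>xs r. pmf (trans M (take r xs) (obs_upto y (r - 1))) (xs ! r) *
      obs M (take (r + 1) xs) (obs_upto y (r - 1)) (y r)"
  \<comment> \<open>Factors up to time \<open>s\<close> look only at the first \<open>s + 1\<close>
    states, which are those of \<open>xs\<close>.\<close>
  have "?f (xs @ z) r = ?f xs r" if "r \<in> {1..s}" for r
    using that xs by (simp add: nth_append)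
  then have *: "(\<Prod>r=1..s. ?f (xs @ z) r) = (\<Prod>r=1..s. ?f xs r)" by (intro prod.cong) auto
  have "{1..s + n} = {1..s} \<union> {Suc s..s + n}" by auto
  then have "(\<Prod>r=1..s + n. ?f (xs @ z) r) = (\<Prod>r=1..s. ?f (xs @ z) r) * (\<Prod>r=Suc s..s + n. ?f (xs @ z) r)"
    by (simp only:) (rule prod.union_disjoint; auto)
  then show ?thesis
    using 0 xs unfolding joint_def * by (auto simp: nth_append)
qed

text \<open>As resampling is regarded as preserving proper weighting only approximately, that claim
  takes three forms: exact for one step from a properly weighted input, exact along runs without
  resampling, and asymptotic in general.\<close>

theorem proposition4:
  fixes M :: "('a::finite, 'y) ssm" and y :: "nat \<Rightarrow> 'y"
    and \<pi> :: "nat \<Rightarrow> 'a list pmf" and \<Delta> t :: nat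
    and q0 :: "'a pmf" and q :: "nat \<Rightarrow> 'a list \<Rightarrow> 'a pmf"
    and dec :: "nat \<Rightarrow> 'a particle multiset \<Rightarrow> bool"
  assumes model: "is_ssm M" "\<And>s. s \<ge> 1 \<Longrightarrow> y s \<in> space (base M)" "\<And>s. evidence M y s > 0"
    and posterior: "\<And>s. \<pi> s = posterior M y s"
    and q0_covers: "\<And>x. pmf (\<pi> 0) [x] > 0 \<Longrightarrow> pmf q0 x > 0"
    and pilot_covers: "\<And>s xs z. length xs = s + 1 \<Longrightarrow> length z = \<Delta> \<Longrightarrow>
          pmf (\<pi> (s + \<Delta>)) (xs @ z) > 0 \<Longrightarrow> pilot_density q xs z > 0"
    and trial_covers: "\<And>s xs zs a. s \<ge> 1 \<Longrightarrow> length xs = s \<Longrightarrow>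
          (\<And>b. zs b \<in> set_pmf (pilot q \<Delta> (xs @ [b]))) \<Longrightarrow>
          pmf (\<pi> s) (xs @ [a]) > 0 \<Longrightarrow> trial_prob \<pi> \<Delta> q s xs zs a > 0"
    and scores_pos: "\<And>m s S j. s \<ge> 1 \<Longrightarrow> S \<in> set_pmf (lookahead \<pi> \<Delta> q0 q dec m (s - 1)) \<Longrightarrow>
          dec s (sample_set m S) \<Longrightarrow> j < m \<Longrightarrow> aux (S j) > 0"
    and t: "t \<ge> 1"
  shows
    "(\<forall>m D. (\<forall>X\<in>set_pmf D. \<forall>j<m. length (fst (X j)) = t) \<longrightarrow>
        (\<forall>j<m. properly_weighted (map_pmf (\<lambda>X. X j) D) (\<pi> (t - 1))) \<longrightarrow>
        (\<forall>j<m. properly_weighted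
           (map_pmf (\<lambda>T. aux_sample \<pi> \<Delta> q t (T j)) (D \<bind> steps \<pi> \<Delta> q m t))
           (prefix_law \<pi> (t + \<Delta>) t))) \<and>
     ((\<forall>s\<in>{1..t}. \<forall>X. \<not> dec s X) \<longrightarrow>
        (\<forall>m. \<forall>j<m. properly_weighted
           (map_pmf (\<lambda>T. aux_sample \<pi> \<Delta> q t (T j)) (lookahead_draws \<pi> \<Delta> q0 q dec m t))
           (prefix_law \<pi> (t + \<Delta>) t))) \<and>
     (\<forall>h j. (\<lambda>m. measure_pmf.expectation (lookahead_draws \<pi> \<Delta> q0 q dec m t)
                   (\<lambda>T. snd (aux_sample \<pi> \<Delta> q t (T j)) * h (fst (aux_sample \<pi> \<Delta> q t (T j)))))
              \<longlonglongrightarrow> measure_pmf.expectation (prefix_law \<pi> (t + \<Delta>) t) h) \<and>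
     (\<forall>h. consistent_estimator (\<lambda>m. lookahead_draws \<pi> \<Delta> q0 q dec m t)
            (estimator \<pi> \<Delta> q t h)
            (measure_pmf.expectation (prefix_law \<pi> (t + \<Delta>) t) h))"
proof -
  have pmf_pi: "pmf (\<pi> s) xs = (if length xs = s + 1 then joint M y s xs / evidence M y s else 0)" for s xs
    unfolding posterior by (rule pmf_posterior[OF model(1,2) model(3)])
  interpret lookahead_run \<pi> \<Delta> q0 q dec
  proof
    show "length xs = Suc s" if "pmf (\<pi> s) xs > 0" for s xs
      using that by (auto simp: pmf_pi split: if_splits)
    \<comment> \<open>A zero joint density of the prefix would make the extension impossible, and
      positive evidence turns a positive joint density into a positive posterior.\<close>
    show "pmf (\<pi> s) xs > 0" if xs: "length xs = Suc s" and pos: "pmf (\<pi> (s + n)) (xs @ z) > 0" for s n xs z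
    proof -
      have "joint M y s xs \<noteq> 0"
        using joint_append_eq_0[OF xs, of M y n z] pos by (auto simp: pmf_pi split: if_splits)
      then show ?thesis
        using joint_nonneg[OF model(1,2) xs] model(3) xs by (simp add: pmf_pi less_le)
    qed
  qed (rule q0_covers pilot_covers trial_covers scores_pos; assumption)+
  obtain u where u: "t = Suc u" using t by (cases t) auto
  have one: "properly_weighted (map_pmf (\<lambda>T. aux_sample \<pi> \<Delta> q t (T j)) (D \<bind> steps \<pi> \<Delta> q m t))
      (prefix_law \<pi> (t + \<Delta>) t)"
    if "\<forall>X\<in>set_pmf D. \<forall>j<m. length (fst (X j)) = t"
      "\<forall>j<m. properly_weighted (map_pmf (\<lambda>X. X j) D) (\<pi> (t - 1))" "j < m" for m D j
    using that t by (intro properly_weighted_aux_steps) auto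
  have two: "properly_weighted (map_pmf (\<lambda>T. aux_sample \<pi> \<Delta> q t (T j)) (lookahead_draws \<pi> \<Delta> q0 q dec m t))
      (prefix_law \<pi> (t + \<Delta>) t)"
    if "\<forall>s\<in>{1..t}. \<forall>X. \<not> dec s X" "j < m" for m j
    unfolding u using that by (intro properly_weighted_lookahead_draws) (auto simp: u)
  have three: "(\<lambda>m. measure_pmf.expectation (lookahead_draws \<pi> \<Delta> q0 q dec m t)
        (\<lambda>T. snd (aux_sample \<pi> \<Delta> q t (T j)) * h (fst (aux_sample \<pi> \<Delta> q t (T j)))))
      \<longlonglongrightarrow> measure_pmf.expectation (prefix_law \<pi> (t + \<Delta>) t) h" for h j
    unfolding u aux_sample_def fst_conv snd_conv by (rule asymptotically_unbiased)
  have four: "consistent_estimator (\<lambda>m. lookahead_draws \<pi> \<Delta> q0 q dec m t) (estimator \<pi> \<Delta> q t h)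
      (measure_pmf.expectation (prefix_law \<pi> (t + \<Delta>) t) h)" for h
    unfolding u by (rule consistent_estimator_lookahead)
  show ?thesis
    by (intro conjI allI impI; (rule one, assumption+ | rule two, assumption+ | rule three | rule four))
qed

end
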